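(* For each $i\in\{1,2,3\}$, the following maps are well defined and bijective. (a) $\varphi_i:\mathfrak{G}_i\to\mathrm{Com}^i(\Delta(B))$ given by $\varphi_i(\tilde{\mathbf{g}})=\mathcal{C}^{\circ}(\tilde{\mathbf{g}},\tilde{\mathbf{g}}-\mathfrak{g}_i)$. (b) $\rho_i:\mathbb{Q}_{\ge0}\to\mathrm{Com}^i(\Delta(B))$ given by $$\rho_i\left(\frac{b}{a}\right)=\mathcal{C}^{\circ}\bigl(\mathfrak{g}_i+a\tilde{\mathbf{v}}_{t_0k_0}+b\tilde{\mathbf{v}}_{k_0s_0},\;a\tilde{\mathbf{v}}_{t_0k_0}+b\tilde{\mathbf{v}}_{k_0s_0}\bigr),$$ where $\frac{b}{a}\in\mathbb{Q}_{\ge0}$ is an irreducible fraction, i.e. $a\in\mathbb{Z}_{\ge1}$, $b\in\mathbb{Z}_{\ge0}$ and $\gcd(a,b)=1$.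
   Context: Fix $p,p',q,q',r,r'\in\mathbb{R}_{>0}$ with $pp'=qq'=rr'=4$ and $pqr=p'q'r'$, a global sign, and $B=\pm\begin{pmatrix}0&-p'&r\\ p&0&-q'\\ -r'&q&0\end{pmatrix}$ ($B$-invariant type). Fix $D=\mathrm{diag}(d_1,d_2,d_3)$ with $d_i>0$ and $DB$ skew-symmetric. A sequence $\mathbf{w}=[k_1,\dots,k_n]$ of elements of $\{1,2,3\}$ is reduced if $k_j\neq k_{j+1}$ for all $j$; $|\mathbf w|=n$; $\mathcal{T}$ is the set of all reduced sequences, including the empty one $\emptyset$; for $k\ne k_n$, $\mathbf{w}[k]=[k_1,\dots,k_n,k]$. Put $B^{\mathbf{w}}=(b_{ij}^{\mathbf{w}})=(-1)^{|\mathbf{w}|}B$. The $c$-vectors $\mathbf{c}_j^{\mathbf{w}}=(c_{ij}^{\mathbf{w}})_{i=1}^3$ and $g$-vectors $\mathbf{g}_j^{\mathbf{w}}=(g_{ij}^{\mathbf{w}})_{i=1}^3$ in $\mathbb{R}^3$ are defined by $\mathbf{c}_j^{\emptyset}=\mathbf{g}_j^{\emptyset}=\mathbf{e}_j$ and: $c_{ik}^{\mathbf{w}[k]}=-c_{ik}^{\mathbf{w}}$; $c_{ij}^{\mathbf{w}[k]}=c_{ij}^{\mathbf{w}}+c_{ik}^{\mathbf{w}}\max(b_{kj}^{\mathbf{w}},0)+\max(-c_{ik}^{\mathbf{w}},0)b_{kj}^{\mathbf{w}}$ for $j\ne k$; $g_{ij}^{\mathbf{w}[k]}=g_{ij}^{\mathbf{w}}$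 for $j\neq k$; $g_{ik}^{\mathbf{w}[k]}=-g_{ik}^{\mathbf{w}}+\sum_{l}g_{il}^{\mathbf{w}}\max(-b_{lk}^{\mathbf{w}},0)-\sum_l b_{il}^{\emptyset}\max(-c_{lk}^{\mathbf{w}},0)$. The modified $g$-vectors are $\tilde{\mathbf{g}}_j^{\mathbf{w}}=d_j^{-1/2}\mathbf{g}_j^{\mathbf{w}}$; $\tilde{\mathbf{e}}_j=d_j^{-1/2}\mathbf{e}_j$. It is known that each $\mathbf{c}_j^{\mathbf{w}}$ is nonzero with all entries $\ge0$ or all entries $\le0$; let $\varepsilon_j^{\mathbf{w}}\in\{\pm1\}$ be its sign. For $\mathbf{w}\neq\emptyset$: $k=K(\mathbf{w})$ is the last index of $\mathbf{w}$; $s=S(\mathbf{w})$ is the (known to be unique) index $s\ne k$ with $\varepsilon_s^{\mathbf{w}}\neq\varepsilon_k^{\mathbf{w}}$ and $\varepsilon_s^{\mathbf{w}}b_{ks}^{\mathbf{w}}<0$; $T(\mathbf{w})$ is the remaining index of $\{1,2,3\}$. For $i\in\{1,2,3\}$ put $k_0=K([i])=i$, $s_0=S([i])$, $t_0=T([i])$ (depending on $i$), $\mathfrak{g}_i=\tilde{\mathbf{e}}_{s_0}+\tilde{\mathbf{e}}_{t_0}-\tilde{\mathbf{e}}_{k_0}$, and $\tilde{\mathbf{v}}_{lm}=\tilde{\mathbf{e}}_m-\tilde{\mathbf{e}}_l$. For vectors $\mathbf{a}_1,\dots,\mathbf{a}_n$: $\mathcal{C}(\mathbf{a}_1,\dots,\mathbf{a}_n)=\{\sum\lambda_j\mathbf{a}_j\mid\lambda_j\ge0\}$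 and $\mathcal{C}^{\circ}(\mathbf{a}_1,\dots,\mathbf{a}_n)=\{\sum\lambda_j\mathbf{a}_j\mid\lambda_j>0\}$. The $G$-fan $\Delta(B)$ is the set of all cones $\mathcal{C}(\tilde{\mathbf{g}}_1^{\mathbf{w}},\tilde{\mathbf{g}}_2^{\mathbf{w}},\tilde{\mathbf{g}}_3^{\mathbf{w}})$, $\mathbf{w}\in\mathcal{T}$, and their faces; $|\Delta(B)|$ is the union of its cones. Let $V=\{x_1\tilde{\mathbf{e}}_1+x_2\tilde{\mathbf{e}}_2+x_3\tilde{\mathbf{e}}_3\mid x_1+x_2+x_3>0\}\cup\{\mathbf{0}\}$ (it contains $|\Delta(B)|$), and $\mathfrak{D}_i=\mathcal{C}(\tilde{\mathbf{e}}_{s_0},\tilde{\mathbf{v}}_{t_0k_0},\tilde{\mathbf{v}}_{k_0s_0})\cap V$. $\mathrm{Com}^i(\Delta(B))$ is the set of all connected components of $V\setminus|\Delta(B)|$ that are contained in $\mathfrak{D}_i$. $\mathfrak{G}_i$ is the set of all modified $g$-vectors lying in $\mathfrak{D}_i$; explicitly, $\mathfrak{G}_i=\{\mathfrak{g}_i+a\tilde{\mathbf{v}}_{t_0k_0}+b\tilde{\mathbf{v}}_{k_0s_0}\mid(a,b)\in\mathbb{Z}_{\ge1}^2,\ \gcd(a,b)=1\}\cup\{\tilde{\mathbf{e}}_{s_0}\}$. *)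

theory Defs
  imports "HOL-Analysis.Analysis"
begin

text \<open>
  Matrices are of type \<open>real^3^3\<close>: \<open>A $ i $ j\<close> is the entry in row \<open>i\<close> and column \<open>j\<close>, and the index
  type \<open>3\<close> has exactly the elements \<open>1\<close>, \<open>2\<close>, \<open>3\<close>.  The initial exchange matrix \<open>B\<close> is an explicit
  parameter of everything below; \<open>d\<close> is the vector of diagonal entries of the skew-symmetrizer.
\<close>

definition diag :: "real^3 \<Rightarrow> real^3^3" where
  "diag d = (\<chi> i j. if i = j then d $ i else 0)"

definition skew_symmetric :: "real^3^3 \<Rightarrow> bool" where
  "skew_symmetric A \<longleftrightarrow> transpose A = - A"


definition reduced_seqs :: "3 list set" where
  "reduced_seqs = {w. distinct_adj w}"

definition B_at :: "real^3^3 \<Rightarrow> 3 list \<Rightarrow> real^3^3" where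
  "B_at B w = (-1) ^ length w *\<^sub>R B"

definition mut_C :: "real^3^3 \<Rightarrow> 3 \<Rightarrow> real^3^3 \<Rightarrow> real^3^3" where
  "mut_C b k C = (\<chi> i j. if j = k then - C $ i $ k
     else C $ i $ j + C $ i $ k * max (b $ k $ j) 0 + max (- C $ i $ k) 0 * b $ k $ j)"

definition mut_G :: "real^3^3 \<Rightarrow> real^3^3 \<Rightarrow> 3 \<Rightarrow> real^3^3 \<Rightarrow> real^3^3 \<Rightarrow> real^3^3" where
  "mut_G b0 b k C G = (\<chi> i j. if j \<noteq> k then G $ i $ j
     else - G $ i $ k + (\<Sum>l\<in>UNIV. G $ i $ l * max (- b $ l $ k) 0)
                      - (\<Sum>l\<in>UNIV. b0 $ i $ l * max (- C $ l $ k) 0))"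

text \<open>
  Sequences grow at the right end, so the recursion runs over the reversed list; the equations in
  terms of the sequence itself are \<open>C_mat_snoc\<close> and \<open>G_mat_snoc\<close>.
\<close>

primrec C_rev :: "real^3^3 \<Rightarrow> 3 list \<Rightarrow> real^3^3" where
  "C_rev B [] = mat 1"
| "C_rev B (k # u) = mut_C (B_at B u) k (C_rev B u)"

primrec G_rev :: "real^3^3 \<Rightarrow> 3 list \<Rightarrow> real^3^3" where
  "G_rev B [] = mat 1"
| "G_rev B (k # u) = mut_G B (B_at B u) k (C_rev B u) (G_rev B u)"

definition C_mat :: "real^3^3 \<Rightarrow> 3 list \<Rightarrow> real^3^3" where
  "C_mat B w = C_rev B (rev w)"

definition G_mat :: "real^3^3 \<Rightarrow> 3 list \<Rightarrow> real^3^3" where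
  "G_mat B w = G_rev B (rev w)"

lemma C_mat_Nil: "C_mat B [] = mat 1"
  by (simp add: C_mat_def)

lemma G_mat_Nil: "G_mat B [] = mat 1"
  by (simp add: G_mat_def)

lemma C_mat_snoc: "C_mat B (w @ [k]) = mut_C (B_at B w) k (C_mat B w)"
  by (simp add: C_mat_def B_at_def)

lemma G_mat_snoc: "G_mat B (w @ [k]) = mut_G B (B_at B w) k (C_mat B w) (G_mat B w)"
  by (simp add: C_mat_def G_mat_def B_at_def)

definition c_vec :: "real^3^3 \<Rightarrow> 3 list \<Rightarrow> 3 \<Rightarrow> real^3" where
  "c_vec B w j = column j (C_mat B w)"

definition g_vec :: "real^3^3 \<Rightarrow> 3 list \<Rightarrow> 3 \<Rightarrow> real^3" where
  "g_vec B w j = column j (G_mat B w)"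

definition mod_g_vec :: "real^3^3 \<Rightarrow> real^3 \<Rightarrow> 3 list \<Rightarrow> 3 \<Rightarrow> real^3" where
  "mod_g_vec B d w j = (1 / sqrt (d $ j)) *\<^sub>R g_vec B w j"

definition mod_e :: "real^3 \<Rightarrow> 3 \<Rightarrow> real^3" where
  "mod_e d j = (1 / sqrt (d $ j)) *\<^sub>R axis j 1"


text \<open>
  The sign of a \<open>c\<close>-vector.  By sign-coherence a \<open>c\<close>-vector is nonzero and all its entries are
  \<open>\<ge> 0\<close> or all are \<open>\<le> 0\<close>, so the second branch is exactly the nonpositive case.
\<close>

definition sgn_c :: "real^3^3 \<Rightarrow> 3 list \<Rightarrow> 3 \<Rightarrow> real" where
  "sgn_c B w j = (if \<forall>i. c_vec B w j $ i \<ge> 0 then 1 else - 1)"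

text \<open>The following three indices are meaningful for nonempty \<open>w\<close> only.\<close>

definition K_ind :: "3 list \<Rightarrow> 3" where
  "K_ind w = last w"

definition S_ind :: "real^3^3 \<Rightarrow> 3 list \<Rightarrow> 3" where
  "S_ind B w = (THE s. s \<noteq> K_ind w \<and> sgn_c B w s \<noteq> sgn_c B w (K_ind w)
                       \<and> sgn_c B w s * B_at B w $ K_ind w $ s < 0)"

definition T_ind :: "real^3^3 \<Rightarrow> 3 list \<Rightarrow> 3" where
  "T_ind B w = (THE t. t \<noteq> K_ind w \<and> t \<noteq> S_ind B w)"


definition closed_cone :: "'a::real_vector list \<Rightarrow> 'a set" where
  "closed_cone as = {\<Sum>j<length as. l j *\<^sub>R as ! j | l. \<forall>j<length as. l j \<ge> (0::real)}"

definition open_cone :: "'a::real_vector list \<Rightarrow> 'a set" where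
  "open_cone as = {\<Sum>j<length as. l j *\<^sub>R as ! j | l. \<forall>j<length as. l j > (0::real)}"

definition G_cone :: "real^3^3 \<Rightarrow> real^3 \<Rightarrow> 3 list \<Rightarrow> (real^3) set" where
  "G_cone B d w = closed_cone [mod_g_vec B d w 1, mod_g_vec B d w 2, mod_g_vec B d w 3]"

text \<open>The empty set satisfies \<open>face_of\<close> but is not a cone, hence is excluded.\<close>

definition G_fan :: "real^3^3 \<Rightarrow> real^3 \<Rightarrow> (real^3) set set" where
  "G_fan B d = {F. F \<noteq> {} \<and> (\<exists>w\<in>reduced_seqs. F face_of G_cone B d w)}"

definition V_set :: "real^3 \<Rightarrow> (real^3) set" where
  "V_set d = {x 1 *\<^sub>R mod_e d 1 + x 2 *\<^sub>R mod_e d 2 + x 3 *\<^sub>R mod_e d 3 | x :: 3 \<Rightarrow> real.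
                x 1 + x 2 + x 3 > 0} \<union> {0}"

definition v_vec :: "real^3 \<Rightarrow> 3 \<Rightarrow> 3 \<Rightarrow> real^3" where
  "v_vec d l m = mod_e d m - mod_e d l"

definition v_tk :: "real^3^3 \<Rightarrow> real^3 \<Rightarrow> 3 \<Rightarrow> real^3" where
  "v_tk B d i = v_vec d (T_ind B [i]) (K_ind [i])"

definition v_ks :: "real^3^3 \<Rightarrow> real^3 \<Rightarrow> 3 \<Rightarrow> real^3" where
  "v_ks B d i = v_vec d (K_ind [i]) (S_ind B [i])"

definition frak_g :: "real^3^3 \<Rightarrow> real^3 \<Rightarrow> 3 \<Rightarrow> real^3" where
  "frak_g B d i = mod_e d (S_ind B [i]) + mod_e d (T_ind B [i]) - mod_e d (K_ind [i])"

definition frak_D :: "real^3^3 \<Rightarrow> real^3 \<Rightarrow> 3 \<Rightarrow> (real^3) set" where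
  "frak_D B d i = closed_cone [mod_e d (S_ind B [i]), v_tk B d i, v_ks B d i] \<inter> V_set d"

definition Com :: "real^3^3 \<Rightarrow> real^3 \<Rightarrow> 3 \<Rightarrow> (real^3) set set" where
  "Com B d i = {X \<in> components (V_set d - \<Union> (G_fan B d)). X \<subseteq> frak_D B d i}"

definition frak_G :: "real^3^3 \<Rightarrow> real^3 \<Rightarrow> 3 \<Rightarrow> (real^3) set" where
  "frak_G B d i = {mod_g_vec B d w j | w j. w \<in> reduced_seqs} \<inter> frak_D B d i"

definition phi :: "real^3^3 \<Rightarrow> real^3 \<Rightarrow> 3 \<Rightarrow> real^3 \<Rightarrow> (real^3) set" where
  "phi B d i g = open_cone [g, g - frak_g B d i]"

text \<open>
  For rational \<open>x\<close>, \<open>quotient_of x = (b, a)\<close> is the unique pair of coprime integers with \<open>a > 0\<close>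
  and \<open>x = b / a\<close>.
\<close>

definition rho :: "real^3^3 \<Rightarrow> real^3 \<Rightarrow> 3 \<Rightarrow> rat \<Rightarrow> (real^3) set" where
  "rho B d i x = (let (b, a) = quotient_of x;
                      u = of_int a *\<^sub>R v_tk B d i + of_int b *\<^sub>R v_ks B d i
                  in open_cone [frak_g B d i + u, u])"

end

theory Submission
  imports Defs
begin

text \<open>
  In the basis \<open>mod_e d j\<close> the exchange matrix becomes that of a cyclic triangle whose arrows are
  all double.  Mutation then replaces one \<open>g\<close>-vector \<open>g\<^sub>k\<close> by \<open>2 g\<^sub>l - g\<^sub>k\<close> for one of
  the two others.  Hence all modified \<open>g\<close>-vectors lie in the affine plane of coordinate sum one,
  and the fan is the cone over a triangulation of a part of this plane: a mutation reflects one
  vertex of a triangle in another vertex.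

  Put the origin of the plane at \<open>frak_g\<close> and measure \<open>(x, y)\<close> along \<open>v_tk\<close> and \<open>v_ks\<close>.  Then
  \<open>frak_D\<close> becomes the quarter plane \<open>x \<ge> 1\<close>, \<open>y \<ge> 0\<close>, and the mutation sequences that start
  with \<open>k\<close> are explicit: a trunk of triangles \<open>(0,-1), (1,n), (1,n+1)\<close>, which fills the part of
  the strip \<open>0 < x \<le> 1\<close> above the initial triangle, and a crown of triangles \<open>u, v, u + v\<close> for
  the neighbours \<open>u, v\<close> in the Farey subdivision of the quarter plane (\<open>reduced_cases\<close>).

  The quarter planes of the three charts are disjoint, and the initial triangle and the three trunks
  cover everything outside them (\<open>covered_or_region\<close>).  Inside, a point is \<open>p u + q v\<close> with
  \<open>p + q \<ge> 1\<close>, and it lies in the triangle \<open>u, v, u + v\<close> iff \<open>p, q \<le> 1\<close>.  If it does not, passing to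
  \<open>u, u + v\<close> or to \<open>u + v, v\<close> subtracts the smaller coefficient from the larger one.  This Euclidean
  descent ends in a triangle unless the point is a multiple \<open>> 1\<close> of a lattice point with coprime
  coordinates (\<open>in_farey_triangle_or_behind\<close>).  Conversely, such a multiple lies in no triangle: its
  coefficients \<open>p, q \<le> 1\<close> would be nonnegative integer multiples of a number \<open>> 1\<close>, hence zero
  (\<open>shadow_uncovered\<close>).  So the
  uncovered part of a quarter plane consists of the open rays behind the lattice points that are
  visible from the origin, and these lattice points are exactly the \<open>g\<close>-vectors in it.

  On the uncovered part of a quarter plane the slope \<open>y / x\<close> is continuous and has rational values
  only, so it is constant on connected sets (\<open>connected_uncovered\<close>).  The rays are therefore the
  connected components, and both maps of the theorem send a visible lattice point, given as a vector
  or as its slope, to the cone over the ray behind it.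
\<close>

section \<open>Mutation along a cyclic triangle of double arrows\<close>

text \<open>
  The exchange matrix of the Markov quiver, with double arrows \<open>i \<rightarrow> j \<rightarrow> k \<rightarrow> i\<close>.
\<close>

definition cyclic :: "real^3^3 \<Rightarrow> 3 \<Rightarrow> 3 \<Rightarrow> 3 \<Rightarrow> bool" where
  "cyclic b i j k \<longleftrightarrow> i \<noteq> j \<and> j \<noteq> k \<and> k \<noteq> i \<and>
     b $ i $ i = 0 \<and> b $ j $ j = 0 \<and> b $ k $ k = 0 \<and>
     b $ i $ j = 2 \<and> b $ j $ k = 2 \<and> b $ k $ i = 2 \<and>
     b $ j $ i = - 2 \<and> b $ k $ j = - 2 \<and> b $ i $ k = - 2"

lemma cyclic_rotate: "cyclic b i j k \<Longrightarrow> cyclic b j k i"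
  by (auto simp: cyclic_def)

lemma cyclic_uminus: "cyclic b i j k \<Longrightarrow> cyclic (- b) k j i"
  by (auto simp: cyclic_def)

lemma forall_3_distinct:
  fixes i j k :: 3
  assumes "i \<noteq> j" "j \<noteq> k" "k \<noteq> i"
  shows "(\<forall>l. P l) \<longleftrightarrow> P i \<and> P j \<and> P k"
  using assms exhaust_3[of i] exhaust_3[of j] exhaust_3[of k] by (auto simp: forall_3)

lemma sum_3_distinct:
  fixes i j k :: 3 and f :: "3 \<Rightarrow> 'a::comm_monoid_add"
  assumes "i \<noteq> j" "j \<noteq> k" "k \<noteq> i"
  shows "sum f UNIV = f i + f j + f k"
proof -
  have "UNIV = {i, j, k}"
    using forall_3_distinct[OF assms, of "\<lambda>l. l \<in> {i, j, k}"] by auto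
  then have "sum f UNIV = sum f {i, j, k}" by (rule arg_cong)
  then show ?thesis using assms by (simp add: add.assoc)
qed

text \<open>
  The two mutation rules below have the same conclusion and differ in the orientation: for a
  nonnegative \<open>c\<close>-vector the reflecting index \<open>l\<close> is the successor of \<open>k\<close>, for a nonpositive one it
  is the predecessor.
\<close>

lemma mut_nonneg:
  assumes b: "cyclic b k l m" and nonneg: "\<And>i. column k C $ i \<ge> 0"
  shows "column k (mut_C b k C) = - column k C"
    and "column l (mut_C b k C) = column l C + 2 *\<^sub>R column k C"
    and "column m (mut_C b k C) = column m C"
    and "column k (mut_G b0 b k C G) = 2 *\<^sub>R column l G - column k G"
    and "column l (mut_G b0 b k C G) = column l G"
    and "column m (mut_G b0 b k C G) = column m G"
proof -
  have d: "k \<noteq> l" "l \<noteq> m" "m \<noteq> k" using b by (auto simp: cyclic_def)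
  have c: "max (- C $ i $ k) 0 = 0" for i
    using nonneg[of i] by (simp add: column_def)
  show "column k (mut_C b k C) = - column k C"
    and "column l (mut_C b k C) = column l C + 2 *\<^sub>R column k C"
    and "column m (mut_C b k C) = column m C"
    and "column k (mut_G b0 b k C G) = 2 *\<^sub>R column l G - column k G"
    and "column l (mut_G b0 b k C G) = column l G"
    and "column m (mut_G b0 b k C G) = column m G"
    using b d by (auto simp: vec_eq_iff column_def mut_C_def mut_G_def cyclic_def c
        sum_3_distinct[OF d])
qed

text \<open>
  Here the correction term of the \<open>g\<close>-vector recursion, a combination of columns of the initial
  matrix, does not vanish.  The hypothesis \<open>dual\<close> is the column \<open>k\<close> of the identity
  \<open>G b = b0 C\<close>; it turns the correction into a combination of \<open>g\<close>-vectors.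
\<close>

lemma mut_nonpos:
  assumes b: "cyclic b l k m" and nonpos: "\<And>i. column k C $ i \<le> 0"
    and dual: "b0 *v column k C = 2 *\<^sub>R (column l G - column m G)"
  shows "column k (mut_C b k C) = - column k C"
    and "column l (mut_C b k C) = column l C + 2 *\<^sub>R column k C"
    and "column m (mut_C b k C) = column m C"
    and "column k (mut_G b0 b k C G) = 2 *\<^sub>R column l G - column k G"
    and "column l (mut_G b0 b k C G) = column l G"
    and "column m (mut_G b0 b k C G) = column m G"
proof -
  have d: "l \<noteq> k" "k \<noteq> m" "m \<noteq> l" using b by (auto simp: cyclic_def)
  have c: "max (- C $ i $ k) 0 = - C $ i $ k" for i
    using nonpos[of i] by (simp add: column_def)
  have dual': "(\<Sum>j\<in>UNIV. b0 $ i $ j * C $ j $ k) = 2 * (G $ i $ l - G $ i $ m)" for i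
    using dual by (simp add: vec_eq_iff matrix_vector_mult_def column_def)
  show "column k (mut_C b k C) = - column k C"
    and "column l (mut_C b k C) = column l C + 2 *\<^sub>R column k C"
    and "column m (mut_C b k C) = column m C"
    and "column l (mut_G b0 b k C G) = column l G"
    and "column m (mut_G b0 b k C G) = column m G"
    using b d by (auto simp: vec_eq_iff column_def mut_C_def mut_G_def cyclic_def c)
  show "column k (mut_G b0 b k C G) = 2 *\<^sub>R column l G - column k G"
    using b d dual' by (auto simp: vec_eq_iff column_def mut_G_def cyclic_def c
         sum_negf sum_3_distinct[OF d])
qed

section \<open>The tree of seeds\<close>

definition entries :: "3 \<Rightarrow> 3 \<Rightarrow> 3 \<Rightarrow> real \<Rightarrow> real \<Rightarrow> real \<Rightarrow> real^3" where
  "entries k s t u v w = (\<chi> j. if j = k then u else if j = s then v else w)"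

text \<open>
  The vector \<open>h (e\<^sub>s + e\<^sub>t - e\<^sub>k) + a (e\<^sub>k - e\<^sub>t) + b (e\<^sub>s - e\<^sub>k)\<close>: the point \<open>(a, b)\<close> of the chart
  \<open>(k, s, t)\<close> at height \<open>h\<close>.
\<close>

definition pt :: "3 \<Rightarrow> 3 \<Rightarrow> 3 \<Rightarrow> real \<Rightarrow> real \<Rightarrow> real \<Rightarrow> real^3" where
  "pt k s t h a b = entries k s t (a - b - h) (h + b) (h - a)"

lemma entries_arith:
  "entries k s t u v w + entries k s t u' v' w' = entries k s t (u + u') (v + v') (w + w')"
  "entries k s t u v w - entries k s t u' v' w' = entries k s t (u - u') (v - v') (w - w')"
  "- entries k s t u v w = entries k s t (- u) (- v) (- w)"
  "c *\<^sub>R entries k s t u v w = entries k s t (c * u) (c * v) (c * w)"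
  by (auto simp: entries_def vec_eq_iff)

lemma entries_cong: "u = u' \<Longrightarrow> v = v' \<Longrightarrow> w = w' \<Longrightarrow> entries k s t u v w = entries k s t u' v' w'"
  by simp

lemma entries_cyclic_mult:
  assumes "cyclic b k s t"
  shows "b *v entries k s t u v w = entries k s t (2 * v - 2 * w) (2 * w - 2 * u) (2 * u - 2 * v)"
proof -
  have d: "k \<noteq> s" "s \<noteq> t" "t \<noteq> k" using assms by (auto simp: cyclic_def)
  have "\<forall>i. (b *v entries k s t u v w) $ i
     = entries k s t (2 * v - 2 * w) (2 * w - 2 * u) (2 * u - 2 * v) $ i"
    using assms d unfolding forall_3_distinct[OF d]
    by (auto simp: matrix_vector_mult_def sum_3_distinct[OF d] entries_def cyclic_def)
  then show ?thesis by (simp add: vec_eq_iff)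
qed

text \<open>
  The seeds after \<open>[k, s, k, s, \<dots>]\<close>, with the indices \<open>P\<close>, \<open>X\<close>, \<open>Y\<close> of their vertices \<open>(0,-1)\<close>,
  \<open>(1,n)\<close>, \<open>(1,n+1)\<close>.  The \<open>c\<close>-vectors are the basis dual to the \<open>g\<close>-vectors; their signs
  and the orientation of \<open>P, X, Y\<close> determine the effect of the next mutation, so both are recorded.
\<close>

definition trunk where
  "trunk N k s t n w P X Y \<longleftrightarrow>
     w \<in> reduced_seqs \<and> w \<noteq> [] \<and> last w = Y \<and> cyclic (B_at N w) P X Y \<and>
     column P (G_mat N w) = pt k s t 1 0 (- 1) \<and>
     column X (G_mat N w) = pt k s t 1 1 (of_nat n) \<and>
     column Y (G_mat N w) = pt k s t 1 1 (of_nat n + 1) \<and>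
     column P (C_mat N w) = entries k s t 0 0 1 \<and>
     column X (C_mat N w) = entries k s t (of_nat n + 2) (of_nat n + 1) 0 \<and>
     column Y (C_mat N w) = entries k s t (- of_nat n - 1) (- of_nat n) 0"

text \<open>
  The seeds whose triangle has the vertices \<open>x\<close>, \<open>x + y\<close>, \<open>y\<close> at the indices \<open>X\<close>, \<open>K\<close>, \<open>Y\<close>.
  The last mutation was at \<open>K\<close>, so only \<open>X\<close> and \<open>Y\<close> can be mutated next.  The signs of the
  \<open>c\<close>-vectors at \<open>X\<close> and \<open>Y\<close> are opposite, and so are the orientations seen from them; hence both
  vertices are reflected in \<open>x + y\<close>.
\<close>

definition crown where
  "crown N k s t x1 x2 y1 y2 w X K Y \<longleftrightarrow>
     w \<in> reduced_seqs \<and> w \<noteq> [] \<and> last w = K \<and> cyclic (B_at N w) X K Y \<and>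
     column X (G_mat N w) = pt k s t 1 (of_int x1) (of_int x2) \<and>
     column Y (G_mat N w) = pt k s t 1 (of_int y1) (of_int y2) \<and>
     column K (G_mat N w) = pt k s t 1 (of_int (x1 + y1)) (of_int (x2 + y2)) \<and>
     column X (C_mat N w) = entries k s t (1 + of_int x1 + of_int x2) (1 + of_int x2) (1 + of_int x1) \<and>
     column Y (C_mat N w) = entries k s t (1 - of_int y1 - of_int y2) (1 - of_int y2) (1 - of_int y1) \<and>
     column K (C_mat N w) = entries k s t (of_int (y1 + y2 - x1 - x2 - 1)) (of_int (y2 - x2 - 1)) (of_int (y1 - x1 - 1))"

text \<open>
  Pairs of vectors \<open>(x1, x2)\<close>, \<open>(y1, y2)\<close> that bound a sector in the successive mediant subdivision
  of the quarter plane, starting from the sectors between \<open>(1, n)\<close> and \<open>(1, n + 1)\<close>; \<open>x\<close> has the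
  smaller slope.
\<close>

inductive farey :: "int \<Rightarrow> int \<Rightarrow> int \<Rightarrow> int \<Rightarrow> bool" where
  base: "n \<ge> 0 \<Longrightarrow> farey 1 n 1 (n + 1)"
| left: "farey x1 x2 y1 y2 \<Longrightarrow> farey x1 x2 (x1 + y1) (x2 + y2)"
| right: "farey x1 x2 y1 y2 \<Longrightarrow> farey (x1 + y1) (x2 + y2) y1 y2"

lemma farey_bounds:
  assumes "farey x1 x2 y1 y2"
  shows "x1 \<ge> 1" "x2 \<ge> 0" "y1 \<ge> 1" "y2 \<ge> 1" "x1 * y2 - x2 * y1 = 1"
  using assms by (induction rule: farey.induct) (auto simp: algebra_simps)

lemma B_at_snoc: "B_at B (w @ [k]) = - B_at B w"
  by (simp add: B_at_def)

lemma reduced_snoc: "w \<in> reduced_seqs \<Longrightarrow> w \<noteq> [] \<Longrightarrow> k \<noteq> last w \<Longrightarrow> w @ [k] \<in> reduced_seqs"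
  by (auto simp: reduced_seqs_def distinct_adj_append_iff)

lemma trunk_start:
  assumes "cyclic N k s t" shows "trunk N k s t 0 [k] t s k"
proof -
  have d: "k \<noteq> s" "s \<noteq> t" "t \<noteq> k" using assms by (auto simp: cyclic_def)
  have m: "column k (mat 1) = entries k s t 1 0 0" "column s (mat 1) = entries k s t 0 1 0"
     "column t (mat 1) = entries k s t 0 0 1"
    using d by (auto simp: vec_eq_iff column_def mat_def entries_def forall_3_distinct[OF d])
  have "column k (mat 1) $ i \<ge> (0::real)" for i
    by (simp add: m entries_def)
  note mut = mut_nonneg[OF assms this]
  show ?thesis using mut cyclic_uminus[OF assms] C_mat_snoc[of N "[]" k] G_mat_snoc[of N "[]" k]
    by (simp add: trunk_def m C_mat_Nil G_mat_Nil entries_arith pt_def B_at_def reduced_seqs_def)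
qed

lemma trunk_up:
  assumes "trunk N k s t n w P X Y" 
  shows "trunk N k s t (Suc n) (w @ [X]) P Y X"
proof -
  have c: "cyclic (B_at N w) X Y P" and "X \<noteq> Y"
    using assms by (auto simp: trunk_def cyclic_def)
  have "column X (C_mat N w) $ i \<ge> 0" for i
    using assms by (auto simp: trunk_def entries_def)
  note mut = mut_nonneg[OF c this]
  show ?thesis using mut assms cyclic_uminus[OF c] \<open>X \<noteq> Y\<close>
    by (simp add: trunk_def C_mat_snoc G_mat_snoc B_at_snoc cyclic_rotate reduced_snoc entries_arith pt_def; intro conjI entries_cong; simp add: algebra_simps)
qed

lemma trunk_crown:
  assumes "trunk N k s t n w P X Y" 
  shows "crown N k s t 1 (int n) 1 (int n + 1) (w @ [P]) X P Y"
proof -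
  have c: "cyclic (B_at N w) P X Y" and "P \<noteq> Y"
    using assms by (auto simp: trunk_def cyclic_def)
  have "column P (C_mat N w) $ i \<ge> 0" for i
    using assms by (auto simp: trunk_def entries_def)
  note mut = mut_nonneg[OF c this]
  show ?thesis using mut assms cyclic_uminus[OF c] \<open>P \<noteq> Y\<close>
    by (simp add: trunk_def crown_def C_mat_snoc G_mat_snoc B_at_snoc cyclic_rotate reduced_snoc entries_arith pt_def; intro conjI entries_cong; simp add: algebra_simps)
qed

lemma crown_right:
  assumes "crown N k s t x1 x2 y1 y2 w X K Y" "farey x1 x2 y1 y2"
  shows "crown N k s t (x1 + y1) (x2 + y2) y1 y2 (w @ [X]) K X Y"
proof -
  have c: "cyclic (B_at N w) X K Y" and "X \<noteq> K"
    using assms by (auto simp: crown_def cyclic_def)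
  have "column X (C_mat N w) $ i \<ge> 0" for i
    using assms farey_bounds[OF assms(2)] by (auto simp: crown_def entries_def)
  note mut = mut_nonneg[OF c this]
  show ?thesis using mut assms(1) cyclic_uminus[OF c] \<open>X \<noteq> K\<close>
    by (simp add: crown_def C_mat_snoc G_mat_snoc B_at_snoc cyclic_rotate reduced_snoc entries_arith pt_def; intro conjI entries_cong; simp add: algebra_simps)
qed

lemma crown_left:
  assumes "crown N k s t x1 x2 y1 y2 w X K Y" "farey x1 x2 y1 y2" "cyclic N k s t"
  shows "crown N k s t x1 x2 (x1 + y1) (x2 + y2) (w @ [Y]) X Y K"
proof -
  have c: "cyclic (B_at N w) K Y X" and "Y \<noteq> K"
    using assms by (auto simp: crown_def cyclic_def)
  have *: "column Y (C_mat N w) $ i \<le> 0" for i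
    using assms farey_bounds[OF assms(2)] by (auto simp: crown_def entries_def)
  have "N *v column Y (C_mat N w) = 2 *\<^sub>R (column K (G_mat N w) - column X (G_mat N w))"
    using assms(1) by (simp add: crown_def entries_cyclic_mult[OF assms(3)] entries_arith pt_def)
  note mut = mut_nonpos[OF c * this]
  show ?thesis using mut assms(1) cyclic_uminus[OF c] \<open>Y \<noteq> K\<close>
    by (simp add: crown_def C_mat_snoc G_mat_snoc B_at_snoc cyclic_rotate reduced_snoc entries_arith pt_def; intro conjI entries_cong; simp add: algebra_simps)
qed

lemma trunk_exists:
  assumes "cyclic N k s t" shows "\<exists>w P X Y. trunk N k s t n w P X Y"
proof (induction n)
  case 0
  show ?case using trunk_start[OF assms] by blast
next
  case (Suc n)
  then obtain w P X Y where "trunk N k s t n w P X Y" by blast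
  from trunk_up[OF this] show ?case by blast
qed

lemma crown_exists:
  assumes "cyclic N k s t" "farey x1 x2 y1 y2" 
  shows "\<exists>w X K Y. crown N k s t x1 x2 y1 y2 w X K Y"
  using assms(2)
proof (induction rule: farey.induct)
  case (base n)
  obtain w P X Y where "trunk N k s t (nat n) w P X Y"
    using trunk_exists[OF assms(1)] by blast
  from trunk_crown[OF this] show ?case using base by auto
next
  case (left x1 x2 y1 y2)
  then obtain w X K Y where "crown N k s t x1 x2 y1 y2 w X K Y" by blast
  from crown_left[OF this left.hyps assms(1)] show ?case by blast
next
  case (right x1 x2 y1 y2)
  then obtain w X K Y where "crown N k s t x1 x2 y1 y2 w X K Y" by blast
  from crown_right[OF this right.hyps] show ?case by blast
qed

lemma forall_cyclic:
  assumes "cyclic b i j k" 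
  shows "(\<forall>l. P l) \<longleftrightarrow> P i \<and> P j \<and> P k"
  using assms by (intro forall_3_distinct) (auto simp: cyclic_def)

lemma sum_cyclic:
  fixes f :: "3 \<Rightarrow> 'a::comm_monoid_add"
  assumes "cyclic b i j k" shows "sum f UNIV = f i + f j + f k"
  using assms by (intro sum_3_distinct) (auto simp: cyclic_def)

text \<open>
  A seed on the trunk continues along the trunk (mutation at \<open>X\<close>) or branches off into the crown
  (mutation at \<open>P\<close>), and a seed of the crown has two continuations inside the crown.
\<close>

lemma reduced_cases:
  assumes orient: "\<And>k. \<exists>s t. cyclic N k s t" and "w \<in> reduced_seqs"
  obtains "w = []"
  | k s t n P X Y where "cyclic N k s t" "trunk N k s t n w P X Y"
  | k s t x1 x2 y1 y2 X K Y where "cyclic N k s t" "farey x1 x2 y1 y2"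
      "crown N k s t x1 x2 y1 y2 w X K Y"
proof -
  have "w = [] \<or> (\<exists>k s t. cyclic N k s t \<and> ((\<exists>n P X Y. trunk N k s t n w P X Y) \<or>
     (\<exists>x1 x2 y1 y2 X K Y. farey x1 x2 y1 y2 \<and> crown N k s t x1 x2 y1 y2 w X K Y)))"
    using assms(2)
  proof (induction w rule: rev_induct)
    case (snoc j w)
    have w: "w \<in> reduced_seqs" and j: "w \<noteq> [] \<Longrightarrow> j \<noteq> last w"
      using snoc.prems by (auto simp: reduced_seqs_def distinct_adj_append_iff)
    from snoc.IH[OF w] consider "w = []"
      | k s t n P X Y where "cyclic N k s t" "trunk N k s t n w P X Y"
      | k s t x1 x2 y1 y2 X K Y where "cyclic N k s t" "farey x1 x2 y1 y2"
          "crown N k s t x1 x2 y1 y2 w X K Y"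
      by blast
    then show ?case
    proof cases
      case 1
      obtain s t where c: "cyclic N j s t" using orient by blast
      have "trunk N j s t 0 (w @ [j]) t s j" using trunk_start[OF c] 1 by simp
      with c show ?thesis by blast
    next
      case 2
      then have "cyclic (B_at N w) P X Y" "j \<noteq> Y" using j by (auto simp: trunk_def)
      then have "j = P \<or> j = X" using forall_cyclic[of _ P X Y "\<lambda>l. l = P \<or> l = X \<or> l = Y"] by blast
      then show ?thesis
      proof
        assume "j = P"
        then show ?thesis
          using 2(1) trunk_crown[OF 2(2)] farey.base[of "int n", OF of_nat_0_le_iff] by blast
      next
        assume "j = X"
        then show ?thesis using 2(1) trunk_up[OF 2(2)] by blast
      qed
    next
      case 3
      then have "cyclic (B_at N w) X K Y" "j \<noteq> K" using j by (auto simp: crown_def)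
      then have "j = X \<or> j = Y" using forall_cyclic[of _ X K Y "\<lambda>l. l = X \<or> l = K \<or> l = Y"] by blast
      then show ?thesis
      proof
        assume "j = X"
        then show ?thesis using 3(1) crown_right[OF 3(3,2)] farey.right[OF 3(2)] by blast
      next
        assume "j = Y"
        then show ?thesis using 3(1) crown_left[OF 3(3,2,1)] farey.left[OF 3(2)] by blast
      qed
    qed
  qed simp
  then show ?thesis
  proof (elim disjE exE conjE)
    assume "w = []" then show thesis by (rule that(1))
  next
    fix k s t n P X Y assume "cyclic N k s t" "trunk N k s t n w P X Y"
    then show thesis by (rule that(2))
  next
    fix k s t x1 x2 y1 y2 X K Y
    assume "cyclic N k s t" "farey x1 x2 y1 y2" "crown N k s t x1 x2 y1 y2 w X K Y"
    then show thesis by (rule that(3))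
  qed
qed

lemma cyclic_unique:
  assumes "cyclic N k s t" "cyclic N k' s' t'"
  shows "k' = k \<and> s' = s \<and> t' = t \<or> k' = s \<and> s' = t \<and> t' = k \<or> k' = t \<and> s' = k \<and> t' = s"
proof -
  have "\<forall>a b. N $ a $ b = 2 \<longrightarrow> (a, b) \<in> {(k, s), (s, t), (t, k)}"
    unfolding forall_cyclic[OF assms(1)] using assms(1) by (simp add: cyclic_def)
  moreover have "N $ k' $ s' = 2" "N $ s' $ t' = 2"
    using assms(2) by (simp_all add: cyclic_def)
  ultimately have "(k', s') \<in> {(k, s), (s, t), (t, k)}" "(s', t') \<in> {(k, s), (s, t), (t, k)}"
    by blast+
  moreover have "k \<noteq> s" "s \<noteq> t" "t \<noteq> k" using assms(1) by (simp_all add: cyclic_def)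
  ultimately show ?thesis by auto
qed

section \<open>Affine charts and chambers\<close>

text \<open>
  The functions \<open>height\<close>, \<open>xcoord t\<close>, \<open>ycoord s\<close> are the coordinates inverse to \<open>pt k s t\<close>.  They are
  linear; the point of the affine plane that belongs to \<open>z\<close> is \<open>(xcoord t z, ycoord s z)\<close> divided by
  \<open>height z\<close>.
\<close>

definition height :: "real^3 \<Rightarrow> real" where "height z = (\<Sum>j\<in>UNIV. z $ j)"

definition xcoord :: "3 \<Rightarrow> real^3 \<Rightarrow> real" where "xcoord t z = height z - z $ t"
definition ycoord :: "3 \<Rightarrow> real^3 \<Rightarrow> real" where "ycoord s z = z $ s - height z"

lemma pt_coords:
  assumes "cyclic N k s t"
  shows "height (pt k s t h a b) = h" "xcoord t (pt k s t h a b) = a" "ycoord s (pt k s t h a b) = b"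
     "pt k s t h a b $ k = a - b - h"  "pt k s t h a b $ s = h + b" "pt k s t h a b $ t = h - a"
proof -
  have "k \<noteq> s" "s \<noteq> t" "t \<noteq> k" using assms by (simp_all add: cyclic_def)
  then show "height (pt k s t h a b) = h" "xcoord t (pt k s t h a b) = a" "ycoord s (pt k s t h a b) = b"
     "pt k s t h a b $ k = a - b - h"  "pt k s t h a b $ s = h + b" "pt k s t h a b $ t = h - a"
    by (simp_all add: xcoord_def ycoord_def height_def sum_cyclic[OF assms] pt_def entries_def)
qed

lemma coords_entries:
  assumes "cyclic N k s t"
  shows "z $ k = xcoord t z - ycoord s z - height z" "z $ s = height z + ycoord s z" "z $ t = height z - xcoord t z"
  by (simp_all add: xcoord_def ycoord_def height_def sum_cyclic[OF assms])

lemma eq_pt_iff: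
  assumes "cyclic N k s t"
  shows "z = pt k s t h a b \<longleftrightarrow> height z = h \<and> xcoord t z = a \<and> ycoord s z = b"
proof
  assume "height z = h \<and> xcoord t z = a \<and> ycoord s z = b"
  then have "\<forall>i. z $ i = pt k s t h a b $ i"
    unfolding forall_cyclic[OF assms] using pt_coords[OF assms] coords_entries[OF assms, of z] by simp
  then show "z = pt k s t h a b" by (simp add: vec_eq_iff)
qed (simp add: pt_coords[OF assms])

lemma pt_arith:
  "pt k s t h a b + pt k s t h' a' b' = pt k s t (h + h') (a + a') (b + b')"
  "c *\<^sub>R pt k s t h a b = pt k s t (c * h) (c * a) (c * b)"
  unfolding pt_def entries_arith by (rule entries_cong; simp add: algebra_simps)+

definition chamber :: "real^3^3 \<Rightarrow> 3 list \<Rightarrow> (real^3) set" where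
  "chamber N w = {\<Sum>j\<in>UNIV. l j *\<^sub>R column j (G_mat N w) | l. \<forall>j. l j \<ge> (0::real)}"

lemma chamber_iff:
  assumes "cyclic b i j k"
  shows "z \<in> chamber N w \<longleftrightarrow> (\<exists>p u v. p \<ge> 0 \<and> u \<ge> 0 \<and> v \<ge> 0 \<and>
    z = p *\<^sub>R column i (G_mat N w) + u *\<^sub>R column j (G_mat N w) + v *\<^sub>R column k (G_mat N w))"
proof
  assume "z \<in> chamber N w"
  then show "\<exists>p u v. p \<ge> 0 \<and> u \<ge> 0 \<and> v \<ge> 0 \<and>
    z = p *\<^sub>R column i (G_mat N w) + u *\<^sub>R column j (G_mat N w) + v *\<^sub>R column k (G_mat N w)"
    by (auto simp: chamber_def sum_cyclic[OF assms])
next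
  assume "\<exists>p u v. p \<ge> 0 \<and> u \<ge> 0 \<and> v \<ge> 0 \<and>
    z = p *\<^sub>R column i (G_mat N w) + u *\<^sub>R column j (G_mat N w) + v *\<^sub>R column k (G_mat N w)"
  then obtain p u v where *: "p \<ge> 0" "u \<ge> 0" "v \<ge> 0"
    "z = p *\<^sub>R column i (G_mat N w) + u *\<^sub>R column j (G_mat N w) + v *\<^sub>R column k (G_mat N w)"
    by blast
  define l where "l = (\<lambda>a. if a = i then p else if a = j then u else v)"
  have "z = (\<Sum>j\<in>UNIV. l j *\<^sub>R column j (G_mat N w))"
    using assms * by (auto simp: sum_cyclic[OF assms] l_def cyclic_def)
  moreover have "\<forall>j. l j \<ge> 0" using * by (simp add: l_def)
  ultimately show "z \<in> chamber N w" by (auto simp: chamber_def)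
qed

lemma chamber_Nil: "z \<in> chamber N [] \<longleftrightarrow> (\<forall>j. z $ j \<ge> 0)"
proof -
  have "(\<Sum>j\<in>UNIV. l j *\<^sub>R column j (G_mat N [])) = (\<chi> j. l j)" for l
    unfolding G_mat_Nil by (simp add: vec_eq_iff column_def mat_def if_distrib sum.If_cases cong: if_cong)
  then have "z \<in> chamber N [] \<longleftrightarrow> (\<exists>l. z = (\<chi> j. l j) \<and> (\<forall>j. l j \<ge> 0))"
    by (simp add: chamber_def)
  also have "\<dots> \<longleftrightarrow> (\<forall>j. z $ j \<ge> 0)" by (auto intro!: exI[of _ "\<lambda>j. z $ j"])
  finally show ?thesis .
qed

lemma chamber_trunk:
  assumes c: "cyclic N k s t" and "trunk N k s t n w P X Y"
  shows "z \<in> chamber N w \<longleftrightarrow> xcoord t z \<le> height z \<and>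
     (of_nat n + 1) * xcoord t z \<le> ycoord s z + height z \<and> ycoord s z + height z \<le> (of_nat n + 2) * xcoord t z"
proof -
  have g: "column P (G_mat N w) = pt k s t 1 0 (- 1)"
    "column X (G_mat N w) = pt k s t 1 1 (of_nat n)"
    "column Y (G_mat N w) = pt k s t 1 1 (of_nat n + 1)"
    using assms(2) by (simp_all add: trunk_def)
  have "cyclic (B_at N w) P X Y" using assms by (simp add: trunk_def)
  note chamber_iff[OF this, of z N w]
  also have "(\<exists>p u v. p \<ge> 0 \<and> u \<ge> 0 \<and> v \<ge> 0 \<and>
    z = p *\<^sub>R column P (G_mat N w) + u *\<^sub>R column X (G_mat N w) + v *\<^sub>R column Y (G_mat N w)) \<longleftrightarrow>
    (\<exists>p u v. p \<ge> 0 \<and> u \<ge> 0 \<and> v \<ge> 0 \<and> height z = p + u + v \<and> xcoord t z = u + v \<and>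
       ycoord s z = u * of_nat n + v * (of_nat n + 1) - p)"
    unfolding g pt_arith eq_pt_iff[OF c] by (simp add: algebra_simps)
  also have "\<dots> \<longleftrightarrow> xcoord t z \<le> height z \<and>
     (of_nat n + 1) * xcoord t z \<le> ycoord s z + height z \<and> ycoord s z + height z \<le> (of_nat n + 2) * xcoord t z"
  proof
    assume "xcoord t z \<le> height z \<and>
     (of_nat n + 1) * xcoord t z \<le> ycoord s z + height z \<and> ycoord s z + height z \<le> (of_nat n + 2) * xcoord t z"
    then show "\<exists>p u v. p \<ge> 0 \<and> u \<ge> 0 \<and> v \<ge> 0 \<and> height z = p + u + v \<and> xcoord t z = u + v \<and>
       ycoord s z = u * of_nat n + v * (of_nat n + 1) - p"
      by (intro exI[of _ "height z - xcoord t z"] exI[of _ "(of_nat n + 2) * xcoord t z - (ycoord s z + height z)"]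
         exI[of _ "ycoord s z + height z - (of_nat n + 1) * xcoord t z"]) (auto simp: algebra_simps)
  qed (auto simp: algebra_simps)
  finally show ?thesis .
qed

text \<open>
  Since \<open>p + q - h\<close>, \<open>h - q\<close> and \<open>h - p\<close> are the barycentric coordinates at height \<open>h\<close>, the cone
  over the triangle \<open>x\<close>, \<open>x + y\<close>, \<open>y\<close> is cut out by \<open>p \<le> h\<close>, \<open>q \<le> h\<close>, \<open>h \<le> p + q\<close>.
\<close>

lemma chamber_crown:
  assumes c: "cyclic N k s t" and "crown N k s t x1 x2 y1 y2 w X K Y"
  shows "z \<in> chamber N w \<longleftrightarrow> (\<exists>p q. xcoord t z = p * of_int x1 + q * of_int y1 \<and>
     ycoord s z = p * of_int x2 + q * of_int y2 \<and> p \<le> height z \<and> q \<le> height z \<and> height z \<le> p + q)"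
proof -
  have g: "column X (G_mat N w) = pt k s t 1 (of_int x1) (of_int x2)"
    "column Y (G_mat N w) = pt k s t 1 (of_int y1) (of_int y2)"
    "column K (G_mat N w) = pt k s t 1 (of_int (x1 + y1)) (of_int (x2 + y2))"
    using assms(2) by (simp_all add: crown_def)
  have "cyclic (B_at N w) X K Y" using assms by (simp add: crown_def)
  note chamber_iff[OF this, of z N w]
  also have "(\<exists>p u v. p \<ge> 0 \<and> u \<ge> 0 \<and> v \<ge> 0 \<and>
    z = p *\<^sub>R column X (G_mat N w) + u *\<^sub>R column K (G_mat N w) + v *\<^sub>R column Y (G_mat N w)) \<longleftrightarrow>
    (\<exists>p u v. p \<ge> 0 \<and> u \<ge> 0 \<and> v \<ge> 0 \<and> height z = p + u + v \<and> 
       xcoord t z = p * of_int x1 + u * of_int (x1 + y1) + v * of_int y1 \<and>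
       ycoord s z = p * of_int x2 + u * of_int (x2 + y2) + v * of_int y2)"
    unfolding g pt_arith eq_pt_iff[OF c] by simp
  also have "\<dots> \<longleftrightarrow> (\<exists>p q. xcoord t z = p * of_int x1 + q * of_int y1 \<and>
     ycoord s z = p * of_int x2 + q * of_int y2 \<and> p \<le> height z \<and> q \<le> height z \<and> height z \<le> p + q)"
    (is "_ = ?R")
  proof
    assume ?R
    then obtain p q where "xcoord t z = p * of_int x1 + q * of_int y1"
     "ycoord s z = p * of_int x2 + q * of_int y2" "p \<le> height z" "q \<le> height z" "height z \<le> p + q"
      by blast
    then show "\<exists>p u v. p \<ge> 0 \<and> u \<ge> 0 \<and> v \<ge> 0 \<and> height z = p + u + v \<and> 
       xcoord t z = p * of_int x1 + u * of_int (x1 + y1) + v * of_int y1 \<and>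
       ycoord s z = p * of_int x2 + u * of_int (x2 + y2) + v * of_int y2"
      by (intro exI[of _ "height z - q"] exI[of _ "p + q - height z"] exI[of _ "height z - p"])
        (auto simp: algebra_simps)
  next
    assume "\<exists>p u v. p \<ge> 0 \<and> u \<ge> 0 \<and> v \<ge> 0 \<and> height z = p + u + v \<and> 
       xcoord t z = p * of_int x1 + u * of_int (x1 + y1) + v * of_int y1 \<and>
       ycoord s z = p * of_int x2 + u * of_int (x2 + y2) + v * of_int y2"
    then obtain p u v where "p \<ge> 0" "u \<ge> 0" "v \<ge> 0" "height z = p + u + v"
       "xcoord t z = p * of_int x1 + u * of_int (x1 + y1) + v * of_int y1"
       "ycoord s z = p * of_int x2 + u * of_int (x2 + y2) + v * of_int y2" by blast
    then show ?R
      by (intro exI[of _ "p + u"] exI[of _ "u + v"]) (auto simp: algebra_simps)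
  qed
  finally show ?thesis .
qed

section \<open>Farey subdivision of a quarter plane\<close>

text \<open>
  The point \<open>(a, b)\<close> at height \<open>h\<close> lies in the cone over some triangle \<open>x\<close>, \<open>x + y\<close>, \<open>y\<close>.
\<close>

definition in_farey_triangle :: "real \<Rightarrow> real \<Rightarrow> real \<Rightarrow> bool" where
  "in_farey_triangle h a b \<longleftrightarrow> (\<exists>x1 x2 y1 y2 p q. farey x1 x2 y1 y2 \<and> 
     a = p * of_int x1 + q * of_int y1 \<and> b = p * of_int x2 + q * of_int y2 \<and> 
     p \<le> h \<and> q \<le> h \<and> h \<le> p + q)"

text \<open>
  Seen from the origin, \<open>(a, b)\<close> is strictly behind a visible lattice point scaled to height \<open>h\<close>.
\<close>

definition behind :: "real \<Rightarrow> real \<Rightarrow> real \<Rightarrow> bool" where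
  "behind h a b \<longleftrightarrow> (\<exists>m n r. 1 \<le> m \<and> 0 \<le> n \<and> coprime m (n::int) \<and> h < r \<and> 
     a = r * of_int m \<and> b = r * of_int n)"

lemma farey_coprime:
  assumes "farey x1 x2 y1 y2"
  shows "coprime x1 x2" "coprime y1 y2" "coprime (x1 + y1) (x2 + y2)"
proof -
  have "coprime u v" if "u * a + v * b = 1" for u v a b :: int
  proof (rule coprimeI)
    fix c assume "c dvd u" "c dvd v"
    then have "c dvd u * a + v * b" by (intro dvd_add dvd_mult2)
    then show "is_unit c" using that by simp
  qed
  from this[of x1 y2 x2 "- y1"] this[of y1 "- x2" y2 x1] this[of "x1 + y1" y2 "x2 + y2" "- y1"]
  show "coprime x1 x2" "coprime y1 y2" "coprime (x1 + y1) (x2 + y2)"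
    using farey_bounds(5)[OF assms] by (simp_all add: algebra_simps)
qed

text \<open>
  While \<open>p > h \<ge> q\<close>, the descent subtracts the same positive number \<open>q\<close> from \<open>p\<close>; the bound \<open>m\<close> on the
  number of subtractions is the induction variable.
\<close>

lemma in_farey_triangle_lower:
  assumes "farey x1 x2 y1 y2" "0 < q" "q \<le> h" "0 \<le> p" "h \<le> p + q" "p \<le> h + of_nat m * q"
  shows "in_farey_triangle h (p * of_int x1 + q * of_int y1) (p * of_int x2 + q * of_int y2)"
  using assms
proof (induction m arbitrary: p y1 y2)
  case 0
  then show ?case unfolding in_farey_triangle_def
    by (intro exI[of _ x1] exI[of _ x2] exI[of _ y1] exI[of _ y2] exI[of _ p] exI[of _ q]) simp
next
  case (Suc m)
  show ?case
  proof (cases "p \<le> h")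
    case True
    then show ?thesis using Suc.prems unfolding in_farey_triangle_def
      by (intro exI[of _ x1] exI[of _ x2] exI[of _ y1] exI[of _ y2] exI[of _ p] exI[of _ q]) simp
  next
    case False
    then have "in_farey_triangle h ((p - q) * of_int x1 + q * of_int (x1 + y1)) 
        ((p - q) * of_int x2 + q * of_int (x2 + y2))"
      using Suc.prems by (intro Suc.IH farey.left) (auto simp: algebra_simps)
    then show ?thesis by (simp add: algebra_simps)
  qed
qed

lemma in_farey_triangle_upper:
  assumes "farey x1 x2 y1 y2" "0 < p" "p \<le> h" "0 \<le> q" "h \<le> p + q" "q \<le> h + of_nat m * p"
  shows "in_farey_triangle h (p * of_int x1 + q * of_int y1) (p * of_int x2 + q * of_int y2)"
  using assms
proof (induction m arbitrary: q x1 x2)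
  case 0
  then show ?case unfolding in_farey_triangle_def
    by (intro exI[of _ x1] exI[of _ x2] exI[of _ y1] exI[of _ y2] exI[of _ p] exI[of _ q]) simp
next
  case (Suc m)
  show ?case
  proof (cases "q \<le> h")
    case True
    then show ?thesis using Suc.prems unfolding in_farey_triangle_def
      by (intro exI[of _ x1] exI[of _ x2] exI[of _ y1] exI[of _ y2] exI[of _ p] exI[of _ q]) simp
  next
    case False
    then have "in_farey_triangle h (p * of_int (x1 + y1) + (q - p) * of_int y1) 
        (p * of_int (x2 + y2) + (q - p) * of_int y2)"
      using Suc.prems by (intro Suc.IH farey.right) (auto simp: algebra_simps)
    then show ?thesis by (simp add: algebra_simps)
  qed
qed

lemma in_farey_triangle_near:
  assumes f: "farey x1 x2 y1 y2" and "0 < p" "0 < q" "h \<le> p + q" "p \<le> h \<or> q \<le> h"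
  shows "in_farey_triangle h (p * of_int x1 + q * of_int y1) (p * of_int x2 + q * of_int y2)"
proof -
  obtain m n :: nat where "(p - h) / q \<le> of_nat m" "(q - h) / p \<le> of_nat n"
    using real_arch_simple by blast
  then have "p \<le> h + of_nat m * q" "q \<le> h + of_nat n * p"
    using assms(2,3) by (simp_all add: field_simps)
  then show ?thesis
    using assms in_farey_triangle_lower[OF f] in_farey_triangle_upper[OF f] by (meson less_imp_le)
qed

text \<open>
  As long as both coefficients exceed \<open>h\<close>, the first coordinate of the point bounds
  \<open>h (x1 + y1)\<close>, and each step of the descent enlarges \<open>x1 + y1\<close> by at least one.  So after finitely
  many steps the coefficients are equal, which puts the point behind \<open>x + y\<close>, or one of them is at
  most \<open>h\<close>.
\<close>

lemma farey_descent:
  assumes "farey x1 x2 y1 y2" "h < p" "h < q" "0 < h"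
    and "p * of_int x1 + q * of_int y1 \<le> h * (of_int (x1 + y1) + of_nat m)"
  shows "in_farey_triangle h (p * of_int x1 + q * of_int y1) (p * of_int x2 + q * of_int y2) \<or>
    behind h (p * of_int x1 + q * of_int y1) (p * of_int x2 + q * of_int y2)"
  using assms
proof (induction m arbitrary: p q x1 x2 y1 y2)
  case 0
  have "h * of_int x1 < p * of_int x1" "h * of_int y1 < q * of_int y1"
    using 0 farey_bounds[OF 0(1)] by simp_all
  then show ?case using 0 by (simp add: algebra_simps)
next
  case (Suc m)
  note f = Suc.prems(1)
  note fb = farey_bounds[OF f]
  consider "p = q" | "p > q" | "p < q" by linarith
  then show ?case
  proof cases
    case 1
    then have "behind h (p * of_int x1 + q * of_int y1) (p * of_int x2 + q * of_int y2)"
      unfolding behind_def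
      using Suc.prems fb farey_coprime(3)[OF f]
      by (intro exI[of _ "x1 + y1"] exI[of _ "x2 + y2"] exI[of _ p]) (simp add: algebra_simps)
    then show ?thesis ..
  next
    case 2
    have e: "(p - q) * of_int x1 + q * of_int (x1 + y1) = p * of_int x1 + q * of_int y1"
      "(p - q) * of_int x2 + q * of_int (x2 + y2) = p * of_int x2 + q * of_int y2"
      by (simp_all add: algebra_simps)
    have "h * 1 \<le> h * of_int x1" using fb Suc.prems by (intro mult_left_mono) auto
    then have m: "(p - q) * of_int x1 + q * of_int (x1 + y1) \<le> h * (of_int (x1 + (x1 + y1)) + of_nat m)"
      using Suc.prems(5) by (simp add: algebra_simps)
    show ?thesis
    proof (cases "h < p - q")
      case True
      from Suc.IH[OF farey.left[OF f] True Suc.prems(3,4) m] show ?thesis unfolding e .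
    next
      case False
      then show ?thesis using in_farey_triangle_near[OF farey.left[OF f], of "p - q" q h] Suc.prems 2
        unfolding e by auto
    qed
  next
    case 3
    have e: "p * of_int (x1 + y1) + (q - p) * of_int y1 = p * of_int x1 + q * of_int y1"
      "p * of_int (x2 + y2) + (q - p) * of_int y2 = p * of_int x2 + q * of_int y2"
      by (simp_all add: algebra_simps)
    have "h * 1 \<le> h * of_int y1" using fb Suc.prems by (intro mult_left_mono) auto
    then have m: "p * of_int (x1 + y1) + (q - p) * of_int y1 \<le> h * (of_int (x1 + y1 + y1) + of_nat m)"
      using Suc.prems(5) by (simp add: algebra_simps)
    show ?thesis
    proof (cases "h < q - p")
      case True
      from Suc.IH[OF farey.right[OF f] Suc.prems(2) True Suc.prems(4) m] show ?thesis unfolding e .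
    next
      case False
      then show ?thesis using in_farey_triangle_near[OF farey.right[OF f], of p "q - p" h] Suc.prems 3
        unfolding e by auto
    qed
  qed
qed

lemma in_farey_triangle_or_behind:
  assumes "0 < h" "h \<le> a" "0 \<le> b"
  shows "in_farey_triangle h a b \<or> behind h a b"
proof -
  \<comment> \<open>The starting sector lies between \<open>(1, n)\<close> and \<open>(1, n + 1)\<close>.\<close>
  define n where "n = \<lfloor>b / a\<rfloor>"
  define q where "q = b - of_int n * a"
  define p where "p = a - q"
  have a: "a > 0" using assms by simp
  have n: "n \<ge> 0" using assms by (simp add: n_def)
  have "of_int n \<le> b / a" "b / a < of_int n + 1" by (simp_all add: n_def)
  then have q: "q \<ge> 0" and p: "p > 0" using a by (simp_all add: q_def p_def field_simps)
  have f: "farey 1 n 1 (n + 1)" using n by (rule farey.base)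
  have e: "a = p * of_int 1 + q * of_int 1" "b = p * of_int n + q * of_int (n + 1)"
    by (simp_all add: p_def q_def algebra_simps)
  show ?thesis
  proof (cases "q = 0")
    case True
    show ?thesis
    proof (cases "p \<le> h")
      case True
      then have "in_farey_triangle h a b"
        unfolding in_farey_triangle_def using f e \<open>q = 0\<close> assms
        by (intro exI[of _ 1] exI[of _ n] exI[of _ "n + 1"] exI[of _ p] exI[of _ q]) auto
      then show ?thesis ..
    next
      case False
      then have "behind h a b" unfolding behind_def using n e \<open>q = 0\<close>
        by (intro exI[of _ 1] exI[of _ n] exI[of _ p]) auto
      then show ?thesis ..
    qed
  next
    case False
    then have q: "q > 0" using q by simp
    show ?thesis
    proof (cases "p \<le> h \<or> q \<le> h")
      case True
      then show ?thesis using in_farey_triangle_near[OF f p q _ True] assms e by simp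
    next
      case False
      obtain m :: nat where "a / h \<le> of_nat m" using real_arch_simple by blast
      then have "a \<le> h * of_nat m" using assms by (simp add: field_simps)
      then have "p * of_int 1 + q * of_int 1 \<le> h * (of_int (1 + 1) + of_nat m)"
        using e assms by (simp add: algebra_simps)
      from farey_descent[OF f _ _ assms(1) this] False show ?thesis unfolding e[symmetric] by simp
    qed
  qed
qed

section \<open>Covered and uncovered points\<close>

text \<open>
  The quiver is a cycle, so every index \<open>k\<close> is the first one of a chart.
\<close>

locale markov =
  fixes N :: "real^3^3"
  assumes orient: "\<exists>s t. cyclic N k s t"

definition covered :: "real^3^3 \<Rightarrow> (real^3) set" where
  "covered N = (\<Union>w\<in>reduced_seqs. chamber N w)"

text \<open>
  The cone, without its apex, over the quarter plane \<open>x \<ge> 1\<close>, \<open>y \<ge> 0\<close> of a chart.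
\<close>

definition region :: "3 \<Rightarrow> 3 \<Rightarrow> (real^3) set" where
  "region s t = {z. 0 < height z \<and> height z \<le> xcoord t z \<and> 0 \<le> ycoord s z}"

text \<open>
  For \<open>a \<ge> 1\<close> this is the cone over the open ray behind \<open>(a, b)\<close>; the equations avoid the scaling
  factor \<open>xcoord t z / a\<close>, which \<open>shadow_scaled\<close> recovers.
\<close>

definition shadow :: "3 \<Rightarrow> 3 \<Rightarrow> int \<Rightarrow> int \<Rightarrow> (real^3) set" where
  "shadow s t a b = {z. 0 < height z \<and> of_int a * ycoord s z = of_int b * xcoord t z \<and>
     of_int a * height z < xcoord t z}"

definition visible :: "int \<Rightarrow> int \<Rightarrow> bool" where
  "visible a b \<longleftrightarrow> 1 \<le> a \<and> 0 \<le> b \<and> coprime a b"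

lemma shadow_scaled:
  assumes "1 \<le> a" "z \<in> shadow s t a b"
  obtains r where "height z < r" "xcoord t z = r * of_int a" "ycoord s z = r * of_int b"
proof
  show "height z < xcoord t z / of_int a" "xcoord t z = xcoord t z / of_int a * of_int a"
    "ycoord s z = xcoord t z / of_int a * of_int b"
    using assms by (auto simp: shadow_def field_simps)
qed

lemma behind_shadow:
  assumes "0 < height z" "behind (height z) (xcoord t z) (ycoord s z)"
  obtains a b where "visible a b" "z \<in> shadow s t a b"
proof -
  obtain m n r where *: "1 \<le> m" "0 \<le> n" "coprime m n" "height z < r" "xcoord t z = r * of_int m" "ycoord s z = r * of_int n"
    using assms(2) unfolding behind_def by blast
  show thesis by (rule that[of m n]) (use * assms(1) in \<open>auto simp: visible_def shadow_def\<close>)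
qed

lemma shadow_subset_region:
  assumes "visible a b" shows "shadow s t a b \<subseteq> region s t"
proof
  fix z assume z: "z \<in> shadow s t a b"
  have a: "1 \<le> a" "0 \<le> b" using assms by (auto simp: visible_def)
  obtain r where r: "height z < r" "xcoord t z = r * of_int a" "ycoord s z = r * of_int b"
    using shadow_scaled[OF a(1) z] .
  have h: "0 < height z" using z by (simp add: shadow_def)
  have "r * 1 \<le> r * of_int a" using a r h by (intro mult_left_mono) auto
  then have "height z \<le> xcoord t z" using r by linarith
  moreover have "0 \<le> ycoord s z" unfolding r using a r h by (intro mult_nonneg_nonneg) auto
  ultimately show "z \<in> region s t" using h by (simp add: region_def)
qed

lemma height_cyclic: "cyclic N k s t \<Longrightarrow> height z = z $ k + z $ s + z $ t"
  by (simp add: height_def sum_cyclic)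

text \<open>
  In terms of entries, the three regions are \<open>z\<^sub>s \<ge> h \<and> z\<^sub>t \<le> 0\<close> and its two cyclic shifts.  Any two
  of them ask for one entry to be both \<open>\<ge> h\<close> and \<open>\<le> 0\<close>.
\<close>

lemma region_unique:
  assumes "cyclic N k s t" "cyclic N k' s' t'" "z \<in> region s t" "z \<in> region s' t'"
  shows "k' = k \<and> s' = s \<and> t' = t"
proof -
  note z = height_cyclic[OF assms(1), of z]
  from cyclic_unique[OF assms(1,2)] show ?thesis
  proof (elim disjE conjE)
    assume "k' = s" "s' = t" "t' = k"
    then have False using assms(3,4) z unfolding region_def mem_Collect_eq xcoord_def ycoord_def by simp
    then show ?thesis ..
  next
    assume "k' = t" "s' = k" "t' = s"
    then have False using assms(3,4) z unfolding region_def mem_Collect_eq xcoord_def ycoord_def by simp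
    then show ?thesis ..
  qed simp
qed

text \<open>
  The triangles of the trunk share the vertex \<open>(0, -1)\<close>; the slope of the point as seen from there
  selects the triangle.
\<close>

lemma trunk_covers:
  assumes c: "cyclic N k s t" and z: "0 < xcoord t z" "xcoord t z \<le> height z" "z $ k \<le> 0"
  shows "z \<in> covered N"
proof -
  define m where "m = \<lfloor>(ycoord s z + height z) / xcoord t z\<rfloor>"
  have "1 \<le> (ycoord s z + height z) / xcoord t z"
    using z coords_entries(1)[OF c, of z] by (simp add: field_simps)
  then have "1 \<le> m" by (simp add: m_def le_floor_iff)
  then have m: "of_int m = real (nat (m - 1)) + 1" by simp
  have "of_int m \<le> (ycoord s z + height z) / xcoord t z" "(ycoord s z + height z) / xcoord t z \<le> of_int m + 1"
    unfolding m_def by linarith+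
  then have *: "(real (nat (m - 1)) + 1) * xcoord t z \<le> ycoord s z + height z"
    "ycoord s z + height z \<le> (real (nat (m - 1)) + 2) * xcoord t z"
    unfolding m using z(1) by (simp_all add: field_simps)
  obtain w P X Y where w: "trunk N k s t (nat (m - 1)) w P X Y"
    using trunk_exists[OF c] by blast
  then have "z \<in> chamber N w" "w \<in> reduced_seqs"
    using chamber_trunk[OF c w, of z] * z by (simp_all add: trunk_def)
  then show ?thesis by (auto simp: covered_def)
qed

lemma crown_covers:
  assumes c: "cyclic N k s t" and z: "in_farey_triangle (height z) (xcoord t z) (ycoord s z)"
  shows "z \<in> covered N"
proof -
  obtain x1 x2 y1 y2 p q where f: "farey x1 x2 y1 y2"
    and *: "xcoord t z = p * of_int x1 + q * of_int y1 \<and> ycoord s z = p * of_int x2 + q * of_int y2 \<and> 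
     p \<le> height z \<and> q \<le> height z \<and> height z \<le> p + q"
    using z unfolding in_farey_triangle_def by blast
  obtain w X K Y where w: "crown N k s t x1 x2 y1 y2 w X K Y"
    using crown_exists[OF c f] by blast
  then have "z \<in> chamber N w" "w \<in> reduced_seqs"
    unfolding chamber_crown[OF c w] using * w by (blast, simp add: crown_def)
  then show ?thesis by (auto simp: covered_def)
qed

lemma region_covered_or_shadow:
  assumes c: "cyclic N k s t" and z: "z \<in> region s t"
  shows "z \<in> covered N \<or> (\<exists>a b. visible a b \<and> z \<in> shadow s t a b)"
  using in_farey_triangle_or_behind[of "height z" "xcoord t z" "ycoord s z"] crown_covers[OF c, of z]
    behind_shadow[of z t s] z by (auto simp: region_def)

lemma (in markov) Nil_covers:
  assumes "\<And>j. 0 \<le> z $ j" shows "z \<in> covered N"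
proof -
  have "z \<in> chamber N []" using assms by (simp add: chamber_Nil)
  then show ?thesis by (force simp: covered_def reduced_seqs_def)
qed

text \<open>
  A point outside the initial triangle has a negative entry \<open>z\<^sub>k\<close>.  In the chart of \<open>k\<close> it belongs to
  the trunk if \<open>0 < x \<le> 1\<close>.  For \<open>x > 1\<close> it lies in the quarter plane of this chart, and for
  \<open>x \<le> 0\<close> in the one with \<open>t\<close> and \<open>k\<close> in the places of \<open>s\<close> and \<open>t\<close>.
\<close>

lemma (in markov) covered_or_region:
  assumes "0 < height z"
  shows "z \<in> covered N \<or> (\<exists>k s t. cyclic N k s t \<and> z \<in> region s t)"
proof (cases "\<forall>j. 0 \<le> z $ j")
  case True
  then show ?thesis using Nil_covers by blast
next
  case False
  then obtain k where k: "z $ k < 0" by (auto simp: not_le)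
  obtain s t where c: "cyclic N k s t" using orient by blast
  note z = height_cyclic[OF c, of z]
  consider "xcoord t z \<le> 0" | "0 < xcoord t z" "xcoord t z \<le> height z" | "height z < xcoord t z" by linarith
  then show ?thesis
  proof cases
    case 1
    then have "z \<in> region t k" using k assms z
      unfolding region_def mem_Collect_eq xcoord_def ycoord_def by linarith
    moreover have "cyclic N s t k" using c by (rule cyclic_rotate)
    ultimately show ?thesis by blast
  next
    case 2
    then show ?thesis using trunk_covers[OF c] k by simp
  next
    case 3
    then have "z \<in> region s t" using k assms z
      unfolding region_def mem_Collect_eq xcoord_def ycoord_def by linarith
    then show ?thesis using c by blast
  qed
qed

text \<open>
  A trunk meets the region of its own chart in the edge \<open>x = 1\<close>, that of the chart \<open>(s', t', k')\<close> in the
  single vertex \<open>(0, -1)\<close>, which is the corner of that region, and the third one not at all.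
\<close>

lemma trunk_meets_region:
  assumes c: "cyclic N k s t" "cyclic N k' s' t'" and w: "trunk N k' s' t' n w P X Y"
    and z: "z \<in> chamber N w" "z \<in> region s t"
  shows "xcoord t z = height z"
proof -
  have *: "xcoord t' z \<le> height z" "(of_nat n + 1) * xcoord t' z \<le> ycoord s' z + height z"
    "ycoord s' z + height z \<le> (of_nat n + 2) * xcoord t' z"
    using z(1) chamber_trunk[OF c(2) w, of z] by auto
  then have x: "0 \<le> xcoord t' z" by (simp add: algebra_simps)
  then have "xcoord t' z \<le> (of_nat n + 1) * xcoord t' z" using mult_right_mono[of 1 "real n + 1"] by simp
  then have y: "xcoord t' z \<le> ycoord s' z + height z" using * by linarith
  note z' = height_cyclic[OF c(1), of z]
  from cyclic_unique[OF c] show ?thesis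
  proof (elim disjE conjE)
    assume "k' = k" "s' = s" "t' = t"
    then show ?thesis using * z(2) by (simp add: region_def)
  next
    assume e: "k' = s" "s' = t" "t' = k"
    then show ?thesis using y z(2) z'
      unfolding region_def mem_Collect_eq xcoord_def ycoord_def by simp
  next
    assume e: "k' = t" "s' = k" "t' = s"
    then have 0: "xcoord t' z = 0" using x z(2) z'
      unfolding region_def mem_Collect_eq xcoord_def ycoord_def by simp
    then have "ycoord s' z + height z = 0" using * by simp
    then show ?thesis using e 0 z' unfolding xcoord_def ycoord_def by simp
  qed
qed

lemma crown_in_region:
  assumes c: "cyclic N k s t" and f: "farey x1 x2 y1 y2" and w: "crown N k s t x1 x2 y1 y2 w X K Y"
    and z: "z \<in> chamber N w" "0 < height z"
  shows "z \<in> region s t"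
proof -
  obtain p q where *: "xcoord t z = p * of_int x1 + q * of_int y1"
     "ycoord s z = p * of_int x2 + q * of_int y2" "p \<le> height z" "q \<le> height z" "height z \<le> p + q"
    using z chamber_crown[OF c w, of z] by blast
  note fb = farey_bounds[OF f]
  have pq: "0 \<le> p" "0 \<le> q" using * by auto
  then have "p * 1 \<le> p * of_int x1" "q * 1 \<le> q * of_int y1"
    using fb by (intro mult_left_mono; simp)+
  moreover have "0 \<le> p * of_int x2 + q * of_int y2"
    using pq fb by (intro add_nonneg_nonneg mult_nonneg_nonneg) auto
  ultimately show ?thesis using * z(2) unfolding region_def mem_Collect_eq by linarith
qed

lemma farey_solve:
  fixes p q :: real
  assumes f: "farey x1 x2 y1 y2"
    and "a = p * of_int x1 + q * of_int y1" "b = p * of_int x2 + q * of_int y2" 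
  shows "p = a * of_int y2 - b * of_int y1" "q = of_int x1 * b - of_int x2 * a"
proof -
  have "real_of_int (x1 * y2 - x2 * y1) = 1" using farey_bounds(5)[OF f] by simp
  then have d: "of_int x1 * of_int y2 - of_int x2 * of_int y1 = (1::real)" by simp
  have "p = p * (of_int x1 * of_int y2 - of_int x2 * of_int y1)" by (simp add: d)
  then show "p = a * of_int y2 - b * of_int y1" unfolding assms(2,3) by (simp add: algebra_simps)
  have "q = q * (of_int x1 * of_int y2 - of_int x2 * of_int y1)" by (simp add: d)
  then show "q = of_int x1 * b - of_int x2 * a" unfolding assms(2,3) by (simp add: algebra_simps)
qed

lemma (in markov) shadow_uncovered:
  assumes c: "cyclic N k s t" and ab: "visible a b" and z: "z \<in> shadow s t a b"
  shows "z \<notin> covered N"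
proof
  assume "z \<in> covered N"
  then obtain w where w: "w \<in> reduced_seqs" "z \<in> chamber N w" by (auto simp: covered_def)
  have reg: "z \<in> region s t" and h: "0 < height z"
    using z shadow_subset_region[OF ab] by (auto simp: region_def)
  have a: "1 \<le> a" using ab by (simp add: visible_def)
  obtain r where r: "height z < r" "xcoord t z = r * of_int a" "ycoord s z = r * of_int b"
    using shadow_scaled[OF a z] .
  have "r * 1 \<le> r * of_int a" using a r h by (intro mult_left_mono) auto
  then have xcoord: "height z < xcoord t z" using r by linarith
  from orient w(1) show False
  proof (cases rule: reduced_cases)
    case 1
    then have "0 \<le> z $ t" using w(2) by (simp add: chamber_Nil)
    then show ?thesis using xcoord by (simp add: xcoord_def)
  next
    case (2 k' s' t' n P X Y)
    then show ?thesis using trunk_meets_region[OF c 2 w(2) reg] xcoord by simp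
  next
    case (3 k' s' t' x1 x2 y1 y2 X K Y)
    have "z \<in> region s' t'" using crown_in_region[OF 3 w(2) h] .
    then have e: "s' = s" "t' = t" using region_unique[OF c 3(1) reg] by simp_all
    obtain p q where *: "xcoord t z = p * of_int x1 + q * of_int y1"
       "ycoord s z = p * of_int x2 + q * of_int y2" "p \<le> height z" "q \<le> height z" "height z \<le> p + q"
      using w(2) chamber_crown[OF 3(1,3), of z] e by blast
    \<comment> \<open>The coordinates \<open>p\<close> and \<open>q\<close> are nonnegative integer multiples of \<open>r\<close>, hence zero.\<close>
    have p: "p = r * of_int (a * y2 - b * y1)" and q: "q = r * of_int (x1 * b - x2 * a)"
      using farey_solve[OF 3(2) *(1,2)] r by (simp_all add: algebra_simps)
    have small: "m = 0" if "0 \<le> r * of_int m" "r * of_int m \<le> height z" for m :: int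
    proof (rule ccontr)
      assume "m \<noteq> 0"
      moreover have "0 \<le> m" using that(1) r h by (simp add: zero_le_mult_iff)
      ultimately have "r * 1 \<le> r * of_int m" using r h by (intro mult_left_mono) auto
      then show False using that r by linarith
    qed
    have "0 \<le> p" "0 \<le> q" using * by auto
    then have "p = 0" "q = 0"
      using small[of "a * y2 - b * y1"] small[of "x1 * b - x2 * a"] *(3,4) unfolding p q by simp_all
    then show ?thesis using * h by simp
  qed
qed

section \<open>The g-vectors in a quarter plane\<close>

text \<open>
  Visible points of equal slope coincide, both coordinates being the reduced terms of the slope.
\<close>

lemma visible_unique:
  assumes "visible a b" "visible m n" "a * n = b * m"
  shows "a = m \<and> b = n"
proof -
  have "a dvd m"
    using assms by (metis visible_def coprime_dvd_mult_right_iff dvd_triv_left)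
  moreover have "m dvd a"
    using assms by (metis visible_def coprime_dvd_mult_left_iff dvd_triv_right)
  ultimately have "a = m" using assms by (intro zdvd_antisym_nonneg) (auto simp: visible_def)
  then show ?thesis using assms by (auto simp: visible_def)
qed

lemma pt_in_region:
  assumes "cyclic N k s t" "1 \<le> a" "0 \<le> b" shows "pt k s t 1 a b \<in> region s t"
  using assms by (simp add: region_def pt_coords[OF assms(1)])

lemma axis_eq_pt:
  assumes c: "cyclic N k s t"
  shows "axis s 1 = pt k s t 1 1 0" "axis t 1 = pt k s t 1 0 (- 1)"
proof -
  have "k \<noteq> s" "s \<noteq> t" "t \<noteq> k" using c by (simp_all add: cyclic_def)
  then show "axis s 1 = pt k s t 1 1 0" "axis t 1 = pt k s t 1 0 (- 1)"
    unfolding eq_pt_iff[OF c] xcoord_def ycoord_def height_cyclic[OF c] by (simp_all add: axis_def)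
qed

lemma axis_in_region:
  assumes c: "cyclic N k s t" and j: "axis j 1 \<in> region s t"
  shows "axis j 1 = pt k s t 1 1 0"
proof -
  have d: "k \<noteq> s" "s \<noteq> t" "t \<noteq> k" using c by (simp_all add: cyclic_def)
  have "j = k \<or> j = s \<or> j = t"
    using forall_cyclic[OF c, of "\<lambda>j. j = k \<or> j = s \<or> j = t"] by blast
  moreover have "j \<noteq> k" "j \<noteq> t"
    using j d unfolding region_def xcoord_def ycoord_def height_cyclic[OF c] by (auto simp: axis_def)
  ultimately show ?thesis using axis_eq_pt[OF c] by blast
qed

lemma farey_visible:
  assumes "farey x1 x2 y1 y2"
  shows "visible x1 x2" "visible y1 y2" "visible (x1 + y1) (x2 + y2)"
  using farey_bounds[OF assms] farey_coprime[OF assms] by (auto simp: visible_def)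

definition g_vectors :: "real^3^3 \<Rightarrow> (real^3) set" where
  "g_vectors N = {column j (G_mat N w) | w j. w \<in> reduced_seqs}"

lemma (in markov) g_vector_cases:
  assumes "z \<in> g_vectors N"
  shows "(\<exists>j. z = axis j 1) \<or>
    (\<exists>k s t a b. cyclic N k s t \<and> visible a b \<and> z = pt k s t 1 (of_int a) (of_int b))"
proof -
  obtain w j where w: "w \<in> reduced_seqs" and zj: "z = column j (G_mat N w)"
    using assms by (auto simp: g_vectors_def)
  from orient w show ?thesis
  proof (cases rule: reduced_cases)
    case 1
    then have "z = axis j 1"
      by (simp add: zj G_mat_Nil vec_eq_iff column_def mat_def axis_def)
    then show ?thesis by blast
  next
    case (2 k s t n P X Y)
    then have "cyclic (B_at N w) P X Y" by (simp add: trunk_def)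
    then have "j = P \<or> j = X \<or> j = Y"
      using forall_cyclic[of _ P X Y "\<lambda>l. l = P \<or> l = X \<or> l = Y"] by blast
    then have "z = axis t 1 \<or> z = pt k s t 1 (of_int 1) (of_int (int n)) \<or>
      z = pt k s t 1 (of_int 1) (of_int (int n + 1))"
      using 2(2) zj axis_eq_pt(2)[OF 2(1)] by (auto simp: trunk_def)
    moreover have "visible 1 (int n)" "visible 1 (int n + 1)" by (auto simp: visible_def)
    ultimately show ?thesis using 2(1) by blast
  next
    case (3 k s t x1 x2 y1 y2 X K Y)
    then have "cyclic (B_at N w) X K Y" by (simp add: crown_def)
    then have "j = X \<or> j = K \<or> j = Y"
      using forall_cyclic[of _ X K Y "\<lambda>l. l = X \<or> l = K \<or> l = Y"] by blast
    then have "z = pt k s t 1 (of_int x1) (of_int x2) \<or> z = pt k s t 1 (of_int y1) (of_int y2) \<or>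
      z = pt k s t 1 (of_int (x1 + y1)) (of_int (x2 + y2))"
      using 3(3) zj by (auto simp: crown_def)
    then show ?thesis using 3(1) farey_visible[OF 3(2)] by blast
  qed
qed

lemma (in markov) height_g_vector:
  assumes "z \<in> g_vectors N" shows "height z = 1"
proof -
  have "height (axis j 1) = 1" for j by (simp add: height_def axis_def)
  then show ?thesis using g_vector_cases[OF assms] pt_coords(1) by blast
qed

lemma (in markov) g_vector_visible:
  assumes c: "cyclic N k s t" and z: "z \<in> g_vectors N" "z \<in> region s t"
  shows "\<exists>a b. visible a b \<and> z = pt k s t 1 (of_int a) (of_int b)"
  using g_vector_cases[OF z(1)]
proof (elim disjE exE conjE)
  fix j assume "z = axis j 1"
  then show ?thesis using axis_in_region[OF c, of j] z(2)
    by (intro exI[of _ 1] exI[of _ 0]) (simp add: visible_def)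
next
  fix k' s' t' a b
  assume c': "cyclic N k' s' t'" and v: "visible a b" and e: "z = pt k' s' t' 1 (of_int a) (of_int b)"
  have "z \<in> region s' t'"
    unfolding e using v by (intro pt_in_region[OF c']) (auto simp: visible_def)
  with region_unique[OF c c' z(2)] e v show ?thesis by blast
qed

text \<open>
  A visible lattice point is not behind another one, so it lies in some triangle \<open>x\<close>, \<open>x + y\<close>, \<open>y\<close>.
  There its coefficients \<open>p, q \<le> 1\<close> are integers because the determinant of \<open>x, y\<close> is one, and the only
  such points of the triangle are its vertices.
\<close>

lemma visible_g_vector:
  assumes c: "cyclic N k s t" and v: "visible a b"
  shows "pt k s t 1 (of_int a) (of_int b) \<in> g_vectors N"
proof -
  have a: "1 \<le> a" "0 \<le> b" using v by (auto simp: visible_def)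
  have "\<not> behind 1 (of_int a) (of_int b)"
  proof
    assume "behind 1 (of_int a) (of_int b)"
    then obtain m n r where *: "1 \<le> m" "0 \<le> n" "coprime m n" "1 < r" "real_of_int a = r * of_int m" "of_int b = r * of_int n"
      unfolding behind_def by blast
    then have "real_of_int (a * n) = of_int (b * m)" by simp
    then have "a * n = b * m" by (simp only: of_int_eq_iff)
    then have "a = m" using visible_unique[OF v, of m n] * by (simp add: visible_def)
    then show False using * by simp
  qed
  then have "in_farey_triangle 1 (of_int a) (of_int b)"
    using in_farey_triangle_or_behind[of 1 "of_int a" "of_int b"] a by simp
  then obtain x1 x2 y1 y2 p q where f: "farey x1 x2 y1 y2"
    and *: "real_of_int a = p * of_int x1 + q * of_int y1" "real_of_int b = p * of_int x2 + q * of_int y2"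
      "p \<le> 1" "q \<le> 1" "1 \<le> p + q"
    unfolding in_farey_triangle_def by blast
  define p' q' where "p' = a * y2 - b * y1" and "q' = x1 * b - x2 * a"
  have pq: "p = of_int p'" "q = of_int q'" using farey_solve[OF f *(1,2)] by (simp_all add: p'_def q'_def)
  have "p' \<le> 1" "q' \<le> 1" "1 \<le> p' + q'" using *(3-5) unfolding pq by linarith+
  then have "(p' = 1 \<and> q' = 0) \<or> (p' = 0 \<and> q' = 1) \<or> (p' = 1 \<and> q' = 1)" by linarith
  moreover have "a = p' * x1 + q' * y1" "b = p' * x2 + q' * y2"
    using *(1,2) unfolding pq by (simp_all flip: of_int_mult of_int_add)
  ultimately have ab: "(a = x1 \<and> b = x2) \<or> (a = y1 \<and> b = y2) \<or> (a = x1 + y1 \<and> b = x2 + y2)"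
    by auto
  obtain w X K Y where w: "crown N k s t x1 x2 y1 y2 w X K Y" using crown_exists[OF c f] by blast
  then have "column X (G_mat N w) = pt k s t 1 (of_int x1) (of_int x2)"
    "column Y (G_mat N w) = pt k s t 1 (of_int y1) (of_int y2)"
    "column K (G_mat N w) = pt k s t 1 (of_int (x1 + y1)) (of_int (x2 + y2))" 
    "w \<in> reduced_seqs"
    by (simp_all add: crown_def)
  then have "pt k s t 1 (of_int x1) (of_int x2) \<in> g_vectors N"
    "pt k s t 1 (of_int y1) (of_int y2) \<in> g_vectors N"
    "pt k s t 1 (of_int (x1 + y1)) (of_int (x2 + y2)) \<in> g_vectors N"
    unfolding g_vectors_def by (metis (mono_tags, lifting) mem_Collect_eq)+
  then show ?thesis using ab by auto
qed

section \<open>Connected sets of uncovered points\<close>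

lemma continuous_coords:
  "continuous_on A height" "continuous_on A (xcoord t)" "continuous_on A (ycoord s)"
  unfolding height_def xcoord_def ycoord_def by (intro continuous_intros)+

text \<open>
  The three regions are relatively closed and disjoint, so a connected uncovered set stays in one of
  them.  There the slope maps it onto a connected, countable set of reals.
\<close>

lemma (in markov) connected_uncovered:
  assumes c: "cyclic N k s t" and v: "visible a b"
    and C: "connected C" "C \<subseteq> {z. 0 < height z} - covered N"
    and x: "x \<in> C" "x \<in> shadow s t a b"
  shows "C \<subseteq> shadow s t a b"
proof -
  define F where "F s t = {z. height z \<le> xcoord t z \<and> 0 \<le> ycoord s z}" for s t
  have closed: "closed (F s t)" for s t
    unfolding F_def by (intro closed_Collect_conj closed_Collect_le continuous_coords continuous_intros)
  have F: "z \<in> region s t \<longleftrightarrow> z \<in> F s t" if "z \<in> C" for z s t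
    using C(2) that by (auto simp: F_def region_def)
  have c': "cyclic N s t k" "cyclic N t k s" using c cyclic_rotate by blast+
  have d: "k \<noteq> s" "s \<noteq> t" "t \<noteq> k" using c by (simp_all add: cyclic_def)
  have "C \<subseteq> F s t \<union> (F t k \<union> F k s)"
  proof
    fix z assume z: "z \<in> C"
    then obtain k' s' t' where c'': "cyclic N k' s' t'" "z \<in> region s' t'"
      using covered_or_region[of z] C(2) by blast
    then show "z \<in> F s t \<union> (F t k \<union> F k s)"
      using cyclic_unique[OF c c''(1)] F[OF z] by blast
  qed
  moreover have "F s t \<inter> (F t k \<union> F k s) \<inter> C = {}"
    using region_unique[OF c c'(1)] region_unique[OF c c'(2)] F d by blast
  moreover have "F s t \<inter> C \<noteq> {}"
    using x F shadow_subset_region[OF v] by blast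
  ultimately have "(F t k \<union> F k s) \<inter> C = {}"
    using C(1) closed unfolding connected_closed by (meson closed_Un)
  with \<open>C \<subseteq> F s t \<union> (F t k \<union> F k s)\<close> have reg: "C \<subseteq> region s t" using F by blast
  define f where "f z = ycoord s z / xcoord t z" for z
  have shadow: "\<exists>m n. visible m n \<and> z \<in> shadow s t m n" if "z \<in> C" for z
    using region_covered_or_shadow[OF c] reg C(2) that by blast
  have f: "f z = of_int n / of_int m" if "visible m n" "z \<in> shadow s t m n" for z m n
    using that shadow_subset_region[OF that(1), of s t] 
    by (auto simp: f_def shadow_def region_def visible_def field_simps)
  have "continuous_on C f"
    unfolding f_def using reg by (intro continuous_intros continuous_coords) (auto simp: region_def)
  then have "connected (f ` C)" using C(1) by (rule connected_continuous_image)
  moreover have "f ` C \<subseteq> \<rat>"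
    using shadow f by fastforce
  then have "countable (f ` C)" using countable_rat countable_subset by blast
  ultimately have const: "f z = f x" if "z \<in> C" for z
    using connected_uncountable[of "f ` C" "f z" "f x"] that x(1) by blast
  show ?thesis
  proof
    fix z assume z: "z \<in> C"
    then obtain m n where mn: "visible m n" "z \<in> shadow s t m n" using shadow by blast
    then have "real_of_int n / of_int m = of_int b / of_int a"
      using const[OF z] f[OF mn] f[OF v x(2)] by simp
    then have "real_of_int (m * b) = of_int (n * a)"
      using mn(1) v by (simp add: visible_def field_simps)
    then have "m * b = n * a" by (simp only: of_int_eq_iff)
    then show "z \<in> shadow s t a b" using visible_unique[OF mn(1) v] mn(2) by simp
  qed
qed

section \<open>Reduction to double arrows\<close>

text \<open>
  Conjugation by the square root of the diagonal matrix of \<open>d\<close>.  It commutes with mutation because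
  the entries are only rescaled by positive factors.
\<close>

definition symmetrize :: "real^3 \<Rightarrow> real^3^3 \<Rightarrow> real^3^3" where
  "symmetrize d A = (\<chi> i j. sqrt (d $ i) * A $ i $ j / sqrt (d $ j))"

text \<open>
  The coordinates with respect to the basis \<open>mod_e d j\<close>.
\<close>

definition mod_coords :: "real^3 \<Rightarrow> real^3 \<Rightarrow> real^3" where
  "mod_coords d z = (\<chi> j. sqrt (d $ j) * z $ j)"

locale skew_symmetrized =
  fixes B :: "real^3^3" and d :: "real^3"
  assumes d_pos: "0 < d $ j"
begin

lemma sqrt_d_pos: "0 < sqrt (d $ j)"
  using d_pos by simp

lemma max_mult: "0 \<le> c \<Longrightarrow> max (c * x) 0 = c * max x (0::real)"
  by (metis max_mult_distrib_left mult_zero_right)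

lemma max_uminus_mult: "0 \<le> c \<Longrightarrow> max (- (c * x)) 0 = c * max (- x) (0::real)"
  using max_mult[of c "- x"] by simp

lemma symmetrize_mult:
  "(\<Sum>l\<in>UNIV. symmetrize d A $ i $ l * max (- symmetrize d A' $ l $ k) 0)
    = sqrt (d $ i) / sqrt (d $ k) * (\<Sum>l\<in>UNIV. A $ i $ l * max (- A' $ l $ k) 0)"
proof -
  have "symmetrize d A $ i $ l * max (- symmetrize d A' $ l $ k) 0
      = sqrt (d $ i) / sqrt (d $ k) * (A $ i $ l * max (- A' $ l $ k) 0)" for l
  proof -
    have "max (- symmetrize d A' $ l $ k) 0 = sqrt (d $ l) / sqrt (d $ k) * max (- A' $ l $ k) 0"
      using max_uminus_mult[of "sqrt (d $ l) / sqrt (d $ k)" "A' $ l $ k"] sqrt_d_pos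
      by (simp add: symmetrize_def less_imp_le)
    then show ?thesis using sqrt_d_pos[of l] by (simp add: symmetrize_def)
  qed
  then show ?thesis by (simp only: sum_distrib_left)
qed

lemma B_at_symmetrize: "B_at (symmetrize d A) w = symmetrize d (B_at A w)"
  by (simp add: B_at_def symmetrize_def vec_eq_iff)

lemma mut_C_symmetrize: "mut_C (symmetrize d b) k (symmetrize d C) = symmetrize d (mut_C b k C)"
proof -
  have "symmetrize d C $ i $ k * max (symmetrize d b $ k $ j) 0
      = sqrt (d $ i) * (C $ i $ k * max (b $ k $ j) 0) / sqrt (d $ j)" for i j
  proof -
    have "max (symmetrize d b $ k $ j) 0 = sqrt (d $ k) / sqrt (d $ j) * max (b $ k $ j) 0"
      using max_mult[of "sqrt (d $ k) / sqrt (d $ j)" "b $ k $ j"] sqrt_d_pos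
      by (simp add: symmetrize_def less_imp_le)
    then show ?thesis using sqrt_d_pos[of k] by (simp add: symmetrize_def)
  qed
  moreover have "max (- symmetrize d C $ i $ k) 0 * symmetrize d b $ k $ j
      = sqrt (d $ i) * (max (- C $ i $ k) 0 * b $ k $ j) / sqrt (d $ j)" for i j
  proof -
    have "max (- symmetrize d C $ i $ k) 0 = sqrt (d $ i) / sqrt (d $ k) * max (- C $ i $ k) 0"
      using max_uminus_mult[of "sqrt (d $ i) / sqrt (d $ k)" "C $ i $ k"] sqrt_d_pos
      by (simp add: symmetrize_def less_imp_le)
    then show ?thesis using sqrt_d_pos[of k] by (simp add: symmetrize_def)
  qed
  ultimately show ?thesis
    by (simp add: mut_C_def vec_eq_iff) (simp add: symmetrize_def distrib_left add_divide_distrib)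
qed

lemma mut_G_symmetrize:
  "mut_G (symmetrize d b0) (symmetrize d b) k (symmetrize d C) (symmetrize d G)
     = symmetrize d (mut_G b0 b k C G)"
  unfolding mut_G_def symmetrize_mult
  by (simp add: vec_eq_iff)
    (simp add: symmetrize_def right_diff_distrib distrib_left add_divide_distrib diff_divide_distrib)

lemma symmetrize_mat_1: "symmetrize d (mat 1) = mat 1"
  using sqrt_d_pos by (simp add: symmetrize_def mat_def vec_eq_iff less_imp_neq[symmetric] d_pos)

lemma C_mat_symmetrize: "C_mat (symmetrize d B) w = symmetrize d (C_mat B w)"
  by (induction w rule: rev_induct)
    (simp_all add: C_mat_Nil C_mat_snoc symmetrize_mat_1 B_at_symmetrize mut_C_symmetrize)

lemma G_mat_symmetrize: "G_mat (symmetrize d B) w = symmetrize d (G_mat B w)"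
  by (induction w rule: rev_induct)
    (simp_all add: G_mat_Nil G_mat_snoc symmetrize_mat_1 B_at_symmetrize C_mat_symmetrize mut_G_symmetrize)

lemma mod_coords_linear:
  "mod_coords d (x + y) = mod_coords d x + mod_coords d y"
  "mod_coords d (x - y) = mod_coords d x - mod_coords d y"
  "mod_coords d (c *\<^sub>R x) = c *\<^sub>R mod_coords d x"
  "mod_coords d 0 = 0"
  by (simp_all add: mod_coords_def vec_eq_iff algebra_simps)

lemma mod_coords_sum: "mod_coords d (\<Sum>x\<in>A. f x) = (\<Sum>x\<in>A. mod_coords d (f x))"
  by (induction A rule: infinite_finite_induct) (simp_all add: mod_coords_linear)

lemma mod_coords_inject: "mod_coords d x = mod_coords d y \<longleftrightarrow> x = y"
  using sqrt_d_pos by (auto simp: mod_coords_def vec_eq_iff less_imp_neq[symmetric] d_pos)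
   
lemma mod_coords_mod_e: "mod_coords d (mod_e d j) = axis j 1"
  using sqrt_d_pos by (simp add: mod_coords_def mod_e_def vec_eq_iff axis_def less_imp_neq[symmetric] d_pos)

lemma mod_coords_mod_g: "mod_coords d (mod_g_vec B d w j) = column j (G_mat (symmetrize d B) w)"
  unfolding G_mat_symmetrize
  by (simp add: mod_coords_def mod_g_vec_def symmetrize_def g_vec_def column_def vec_eq_iff)

lemma G_cone_iff: "z \<in> G_cone B d w \<longleftrightarrow> mod_coords d z \<in> chamber (symmetrize d B) w"
proof -
  have cone: "z \<in> G_cone B d w \<longleftrightarrow>
      (\<exists>l. (\<forall>j. l j \<ge> (0::real)) \<and> z = (\<Sum>j\<in>UNIV. l j *\<^sub>R mod_g_vec B d w j))" (is "?L \<longleftrightarrow> ?R")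
  proof
    assume ?L
    then obtain l :: "nat \<Rightarrow> real" where l: "\<forall>j<3. l j \<ge> 0"
      "z = l 0 *\<^sub>R mod_g_vec B d w 1 + l 1 *\<^sub>R mod_g_vec B d w 2 + l 2 *\<^sub>R mod_g_vec B d w 3"
      by (auto simp: G_cone_def closed_cone_def eval_nat_numeral add.assoc)
    define m where "m j = (if j = (1::3) then l 0 else if j = 2 then l 1 else l 2)" for j
    have "z = (\<Sum>j\<in>UNIV. m j *\<^sub>R mod_g_vec B d w j)"
      by (simp add: l(2) sum_3 m_def)
    moreover have "\<forall>j. m j \<ge> 0" using l(1) by (simp add: m_def)
    ultimately show ?R by blast
  next
    assume ?R
    then obtain l :: "3 \<Rightarrow> real" where l: "\<forall>j. l j \<ge> 0"
      "z = l 1 *\<^sub>R mod_g_vec B d w 1 + l 2 *\<^sub>R mod_g_vec B d w 2 + l 3 *\<^sub>R mod_g_vec B d w 3"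
      by (auto simp: sum_3)
    then show ?L
      unfolding G_cone_def closed_cone_def
      by (intro CollectI exI[of _ "\<lambda>i. if i = 0 then l 1 else if i = 1 then l 2 else l 3"])
        (simp add: eval_nat_numeral add.assoc)
  qed
  show ?thesis
    unfolding cone chamber_def mod_coords_inject[of z, symmetric] mod_coords_sum mod_coords_linear
      mod_coords_mod_g by blast
qed

text \<open>
  Faces do not contribute to the union, since every cone is a face of itself.
\<close>

lemma mem_G_fan: "z \<in> \<Union> (G_fan B d) \<longleftrightarrow> mod_coords d z \<in> covered (symmetrize d B)"
proof -
  have "convex (chamber N w)" for N w
  proof (rule convexI)
    fix x y :: "real^3" and u v :: real
    assume "x \<in> chamber N w" "y \<in> chamber N w" and uv: "0 \<le> u" "0 \<le> v"
    then obtain l m where "x = (\<Sum>j\<in>UNIV. l j *\<^sub>R column j (G_mat N w))" "\<forall>j. 0 \<le> l j"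
      "y = (\<Sum>j\<in>UNIV. m j *\<^sub>R column j (G_mat N w))" "\<forall>j. 0 \<le> m j"
      unfolding chamber_def by blast
    then show "u *\<^sub>R x + v *\<^sub>R y \<in> chamber N w"
      unfolding chamber_def using uv
      by (intro CollectI exI[of _ "\<lambda>j. u * l j + v * m j"])
        (simp add: scaleR_add_left sum.distrib scaleR_sum_right)
  qed
  moreover have "G_cone B d w = mod_coords d -` chamber (symmetrize d B) w" for w
    by (auto simp: G_cone_iff)
  moreover have "linear (mod_coords d)" by (intro linearI) (simp_all add: mod_coords_linear)
  ultimately have "convex (G_cone B d w)" for w by (simp add: convex_linear_vimage)
  then have face: "G_cone B d w face_of G_cone B d w" for w by (simp add: face_of_refl_eq)
  have "z \<in> \<Union> (G_fan B d) \<longleftrightarrow> (\<exists>w\<in>reduced_seqs. z \<in> G_cone B d w)"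
  proof
    assume "z \<in> \<Union> (G_fan B d)"
    then show "\<exists>w\<in>reduced_seqs. z \<in> G_cone B d w"
      unfolding G_fan_def by (auto dest!: face_of_imp_subset)
  next
    assume "\<exists>w\<in>reduced_seqs. z \<in> G_cone B d w"
    then show "z \<in> \<Union> (G_fan B d)" unfolding G_fan_def using face by blast
  qed
  then show ?thesis by (auto simp: covered_def G_cone_iff)
qed

lemma mem_V_set: "z \<in> V_set d \<longleftrightarrow> z = 0 \<or> 0 < height (mod_coords d z)"
proof -
  have coords_entries: "mod_coords d (x 1 *\<^sub>R mod_e d 1 + x 2 *\<^sub>R mod_e d 2 + x 3 *\<^sub>R mod_e d 3) = (\<chi> j. x j)"
    for x :: "3 \<Rightarrow> real"
    by (simp add: mod_coords_linear mod_coords_mod_e vec_eq_iff forall_3 axis_def)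
  have "(\<exists>x :: 3 \<Rightarrow> real. z = x 1 *\<^sub>R mod_e d 1 + x 2 *\<^sub>R mod_e d 2 + x 3 *\<^sub>R mod_e d 3 \<and> 0 < x 1 + x 2 + x 3) \<longleftrightarrow>
    0 < height (mod_coords d z)"
    unfolding mod_coords_inject[of z, symmetric] coords_entries
  proof
    assume "0 < height (mod_coords d z)"
    then show "\<exists>x :: 3 \<Rightarrow> real. mod_coords d z = (\<chi> j. x j) \<and> 0 < x 1 + x 2 + x 3"
      by (intro exI[of _ "\<lambda>j. mod_coords d z $ j"]) (simp add: height_def sum_3)
  qed (auto simp: height_def sum_3)
  then show ?thesis unfolding V_set_def Un_iff mem_Collect_eq by blast
qed

text \<open>
  The skew-symmetrizer makes the two entries opposite, and their product is \<open>- x y = - 4\<close>.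
\<close>

lemma symmetrize_pair:
  assumes B: "B $ i $ j = \<tau> * x" "B $ j $ i = - \<tau> * y"
    and xy: "0 < x" "0 < y" "x * y = 4"
    and skew: "d $ j * B $ j $ i = - (d $ i * B $ i $ j)" and tau: "\<tau> = 1 \<or> \<tau> = - 1"
  shows "symmetrize d B $ i $ j = 2 * \<tau>" "symmetrize d B $ j $ i = - 2 * \<tau>"
proof -
  have e: "d $ j * y = d $ i * x" using skew tau by (auto simp: B)
  have sq: "sqrt a * u = 2 * sqrt b"
    if "0 < a" "0 < b" "0 < u" "a * u = b * v" "u * v = 4" for a b u v :: real
  proof (rule power2_eq_imp_eq)
    have "(sqrt a * u)\<^sup>2 = (a * u) * u" using that(1) by (simp add: power_mult_distrib power2_eq_square)
    also have "\<dots> = b * (u * v)" unfolding that(4) by (simp add: mult.assoc mult.commute[of v])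
    finally show "(sqrt a * u)\<^sup>2 = (2 * sqrt b)\<^sup>2" using that by (simp add: power_mult_distrib)
  qed (use that in auto)
  have "sqrt (d $ i) * x = 2 * sqrt (d $ j)" "sqrt (d $ j) * y = 2 * sqrt (d $ i)"
    using sq[of "d $ i" "d $ j" x y] sq[of "d $ j" "d $ i" y x] d_pos xy e by (simp_all add: mult.commute)
  then show "symmetrize d B $ i $ j = 2 * \<tau>" "symmetrize d B $ j $ i = - 2 * \<tau>"
    using sqrt_d_pos[of i] sqrt_d_pos[of j] tau by (auto simp: symmetrize_def B)
qed

end

section \<open>The two bijections\<close>

lemma convex_open_cone: "convex (open_cone xs)"
proof (rule convexI)
  fix x y and u v :: real
  assume "x \<in> open_cone xs" "y \<in> open_cone xs" and uv: "0 \<le> u" "0 \<le> v" "u + v = 1"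
  then obtain l m where lm: "x = (\<Sum>j<length xs. l j *\<^sub>R xs ! j)" "\<forall>j<length xs. 0 < l j"
    "y = (\<Sum>j<length xs. m j *\<^sub>R xs ! j)" "\<forall>j<length xs. 0 < m j"
    unfolding open_cone_def by blast
  have "0 < u * l j + v * m j" if "j < length xs" for j
  proof (cases "u = 0")
    case True
    then show ?thesis using lm uv that by simp
  next
    case False
    then show ?thesis using lm uv that by (intro add_pos_nonneg) (simp_all add: less_imp_le)
  qed
  then show "u *\<^sub>R x + v *\<^sub>R y \<in> open_cone xs"
    unfolding open_cone_def lm
    by (intro CollectI exI[of _ "\<lambda>j. u * l j + v * m j"])
      (simp add: scaleR_add_left sum.distrib scaleR_sum_right)
qed

text \<open>
  The chart that belongs to the index \<open>k\<close>; \<open>s\<close> and \<open>t\<close> turn out to be \<open>S_ind B [k]\<close> and \<open>T_ind B [k]\<close>.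
\<close>

locale chart = skew_symmetrized B d + markov "symmetrize d B" for B d +
  fixes k s t :: 3
  assumes cyc: "cyclic (symmetrize d B) k s t"
begin

lemma S_ind_chart: "S_ind B [k] = s"
  unfolding S_ind_def
proof (rule the_equality)
  have d: "k \<noteq> s" "s \<noteq> t" "t \<noteq> k" using cyc by (simp_all add: cyclic_def)
  have sgn: "sgn_c B [k] j = (if j = k then - 1 else 1)" for j
  proof -
    have C: "c_vec B [k] j $ i = (if j = k then - axis k 1 $ i else axis j 1 $ i + axis k 1 $ i * max (B $ k $ j) 0)" for i
      using C_mat_snoc[of B "[]" k]
      by (simp add: c_vec_def column_def C_mat_Nil mut_C_def B_at_def mat_def axis_def)
    show ?thesis
    proof (cases "j = k")
      case True
      then have "\<not> 0 \<le> c_vec B [k] j $ k" unfolding C by (simp add: axis_def)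
      then show ?thesis using True by (auto simp: sgn_c_def)
    next
      case False
      then have "0 \<le> c_vec B [k] j $ i" for i unfolding C by (simp add: axis_def)
      then show ?thesis using False by (simp add: sgn_c_def)
    qed
  qed
  have pos: "0 < B $ k $ j \<longleftrightarrow> 0 < symmetrize d B $ k $ j" for j
  proof -
    define c where "c = sqrt (d $ k) / sqrt (d $ j)"
    have "0 < c" using sqrt_d_pos by (simp only: c_def divide_pos_pos)
    moreover have "symmetrize d B $ k $ j = c * B $ k $ j" by (simp add: symmetrize_def c_def)
    ultimately show ?thesis by (simp add: zero_less_mult_iff)
  qed
  have S: "(x \<noteq> K_ind [k] \<and> sgn_c B [k] x \<noteq> sgn_c B [k] (K_ind [k]) \<and>
     sgn_c B [k] x * B_at B [k] $ K_ind [k] $ x < 0) \<longleftrightarrow> x \<noteq> k \<and> 0 < B $ k $ x" for x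
    by (auto simp: sgn K_ind_def B_at_def)
  show "s \<noteq> K_ind [k] \<and> sgn_c B [k] s \<noteq> sgn_c B [k] (K_ind [k]) \<and>
     sgn_c B [k] s * B_at B [k] $ K_ind [k] $ s < 0"
    unfolding S pos using cyc by (auto simp: cyclic_def)
  fix x assume "x \<noteq> K_ind [k] \<and> sgn_c B [k] x \<noteq> sgn_c B [k] (K_ind [k]) \<and>
     sgn_c B [k] x * B_at B [k] $ K_ind [k] $ x < 0"
  then have "0 < symmetrize d B $ k $ x" unfolding S pos by simp
  moreover have "\<forall>x. 0 < symmetrize d B $ k $ x \<longrightarrow> x = s"
    unfolding forall_cyclic[OF cyc] using cyc by (simp add: cyclic_def)
  ultimately show "x = s" by blast
qed

lemma T_ind_chart: "T_ind B [k] = t"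
  unfolding T_ind_def S_ind_chart K_ind_def
proof (rule the_equality)
  show "t \<noteq> last [k] \<and> t \<noteq> s" using cyc by (auto simp: cyclic_def)
  have "\<forall>x. x = k \<or> x = s \<or> x = t" unfolding forall_cyclic[OF cyc] by simp
  then show "x = t" if "x \<noteq> last [k] \<and> x \<noteq> s" for x using that by auto
qed

abbreviation co :: "real^3 \<Rightarrow> real^3" where "co \<equiv> mod_coords d"
abbreviation origin :: "real^3" where "origin \<equiv> frak_g B d k"
abbreviation dir :: "int \<Rightarrow> int \<Rightarrow> real^3" where
  "dir a b \<equiv> of_int a *\<^sub>R v_tk B d k + of_int b *\<^sub>R v_ks B d k"
abbreviation ray :: "int \<Rightarrow> int \<Rightarrow> (real^3) set" where
  "ray a b \<equiv> open_cone [origin + dir a b, dir a b]"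

lemma co_origin: "co origin = pt k s t 1 0 0"
  and co_v_tk: "co (v_tk B d k) = pt k s t 0 1 0"
  and co_v_ks: "co (v_ks B d k) = pt k s t 0 0 1"
  and co_e: "co (mod_e d (S_ind B [k])) = pt k s t 1 1 0"
proof -
  have "k \<noteq> s" "s \<noteq> t" "t \<noteq> k" using cyc by (simp_all add: cyclic_def)
  then show "co origin = pt k s t 1 0 0" "co (v_tk B d k) = pt k s t 0 1 0" "co (v_ks B d k) = pt k s t 0 0 1"
    "co (mod_e d (S_ind B [k])) = pt k s t 1 1 0"
    unfolding frak_g_def v_tk_def v_ks_def v_vec_def S_ind_chart T_ind_chart mod_coords_linear mod_coords_mod_e
      K_ind_def eq_pt_iff[OF cyc] xcoord_def ycoord_def height_cyclic[OF cyc]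
    by (simp_all add: axis_def)
qed

lemma co_dir: "co (x *\<^sub>R v_tk B d k + y *\<^sub>R v_ks B d k) = pt k s t 0 x y"
  by (simp add: mod_coords_linear co_v_tk co_v_ks pt_arith)

lemma co_origin_dir: "co (origin + (x *\<^sub>R v_tk B d k + y *\<^sub>R v_ks B d k)) = pt k s t 1 x y"
  unfolding mod_coords_linear(1)[of origin] co_dir co_origin pt_arith by simp

lemma height_co_0: "height (co 0) = 0"
  by (simp add: mod_coords_linear height_def)

text \<open>
  For \<open>l, m > 0\<close>, the vector \<open>l (origin + u) + m u\<close> has height \<open>l\<close> and lies over the multiple
  \<open>(l + m) / l > 1\<close> of the lattice point of \<open>u\<close>.
\<close>

lemma mem_ray: 
  assumes "visible a b"
  shows "z \<in> ray a b \<longleftrightarrow> co z \<in> shadow s t a b"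
proof -
  have a: "1 \<le> a" using assms by (simp add: visible_def)
  have comb: "co (l *\<^sub>R (origin + dir a b) + m *\<^sub>R dir a b)
      = pt k s t l ((l + m) * of_int a) ((l + m) * of_int b)" for l m
    unfolding mod_coords_linear(1)[of "l *\<^sub>R (origin + dir a b)"] mod_coords_linear(3)[of _ "origin + dir a b"]
      mod_coords_linear(3)[of _ "dir a b"] co_origin_dir co_dir pt_arith
    by (simp add: algebra_simps)
  have "z \<in> ray a b \<longleftrightarrow> (\<exists>l m. 0 < l \<and> 0 < m \<and> z = l *\<^sub>R (origin + dir a b) + m *\<^sub>R dir a b)"
  proof
    assume "z \<in> ray a b"
    then obtain f :: "nat \<Rightarrow> real" where "0 < f 0" "0 < f 1" "z = f 0 *\<^sub>R (origin + dir a b) + f 1 *\<^sub>R dir a b"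
      unfolding open_cone_def by (auto simp: eval_nat_numeral)
    then show "\<exists>l m. 0 < l \<and> 0 < m \<and> z = l *\<^sub>R (origin + dir a b) + m *\<^sub>R dir a b" by blast
  next
    assume "\<exists>l m. 0 < l \<and> 0 < m \<and> z = l *\<^sub>R (origin + dir a b) + m *\<^sub>R dir a b"
    then obtain l m where "0 < l" "0 < m" "z = l *\<^sub>R (origin + dir a b) + m *\<^sub>R dir a b" by blast
    then show "z \<in> ray a b"
      unfolding open_cone_def
      by (intro CollectI exI[of _ "\<lambda>i. if i = 0 then l else m"]) (simp add: eval_nat_numeral)
  qed
  also have "\<dots> \<longleftrightarrow> (\<exists>l m. 0 < l \<and> 0 < m \<and> height (co z) = l \<and>
     xcoord t (co z) = (l + m) * of_int a \<and> ycoord s (co z) = (l + m) * of_int b)"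
    unfolding mod_coords_inject[of z, symmetric] comb eq_pt_iff[OF cyc] ..
  also have "\<dots> \<longleftrightarrow> co z \<in> shadow s t a b"
  proof
    assume z: "co z \<in> shadow s t a b"
    obtain r where "height (co z) < r" "xcoord t (co z) = r * of_int a" "ycoord s (co z) = r * of_int b"
      using shadow_scaled[OF a z] .
    then show "\<exists>l m. 0 < l \<and> 0 < m \<and> height (co z) = l \<and>
     xcoord t (co z) = (l + m) * of_int a \<and> ycoord s (co z) = (l + m) * of_int b"
      using z by (intro exI[of _ "height (co z)"] exI[of _ "r - height (co z)"]) (simp add: shadow_def)
  qed (use a in \<open>auto simp: shadow_def\<close>)
  finally show ?thesis .
qed

lemma ray_nonempty: "ray a b \<noteq> {}"
proof -
  have "(\<Sum>j<length [origin + dir a b, dir a b]. 1 *\<^sub>R [origin + dir a b, dir a b] ! j) \<in> ray a b"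
    unfolding open_cone_def by (intro CollectI exI[of _ "\<lambda>_. 1"]) simp
  then show ?thesis by blast
qed

lemma mem_frak_D: "z \<in> frak_D B d k \<longleftrightarrow> z = 0 \<or> co z \<in> region s t"
proof -
  have "z \<in> closed_cone [mod_e d (S_ind B [k]), v_tk B d k, v_ks B d k] \<longleftrightarrow>
    (\<exists>l m n. 0 \<le> l \<and> 0 \<le> m \<and> 0 \<le> n \<and>
      z = l *\<^sub>R mod_e d (S_ind B [k]) + (m *\<^sub>R v_tk B d k + n *\<^sub>R v_ks B d k))" (is "?L \<longleftrightarrow> ?R")
  proof
    assume ?L
    then obtain f :: "nat \<Rightarrow> real" where "0 \<le> f 0" "0 \<le> f 1" "0 \<le> f 2"
      "z = f 0 *\<^sub>R mod_e d (S_ind B [k]) + (f 1 *\<^sub>R v_tk B d k + f 2 *\<^sub>R v_ks B d k)"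
      unfolding closed_cone_def by (auto simp: eval_nat_numeral add.assoc)
    then show ?R by blast
  next
    assume ?R
    then obtain l m n where "0 \<le> l" "0 \<le> m" "0 \<le> n"
      "z = l *\<^sub>R mod_e d (S_ind B [k]) + (m *\<^sub>R v_tk B d k + n *\<^sub>R v_ks B d k)" by blast
    then show ?L
      unfolding closed_cone_def
      by (intro CollectI exI[of _ "\<lambda>i. if i = 0 then l else if i = 1 then m else n"])
        (simp add: eval_nat_numeral add.assoc)
  qed
  also have "\<dots> \<longleftrightarrow> (\<exists>l m n. 0 \<le> l \<and> 0 \<le> m \<and> 0 \<le> n \<and>
      height (co z) = l \<and> xcoord t (co z) = l + m \<and> ycoord s (co z) = n)"
    unfolding mod_coords_inject[of z, symmetric] mod_coords_linear(1)[of "_ *\<^sub>R mod_e _ _"]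
      mod_coords_linear(3) co_e co_dir
    by (simp add: pt_arith eq_pt_iff[OF cyc])
  also have "\<dots> \<longleftrightarrow> 0 \<le> height (co z) \<and> height (co z) \<le> xcoord t (co z) \<and> 0 \<le> ycoord s (co z)"
  proof
    assume "0 \<le> height (co z) \<and> height (co z) \<le> xcoord t (co z) \<and> 0 \<le> ycoord s (co z)"
    then show "\<exists>l m n. 0 \<le> l \<and> 0 \<le> m \<and> 0 \<le> n \<and>
      height (co z) = l \<and> xcoord t (co z) = l + m \<and> ycoord s (co z) = n"
      by (intro exI[of _ "height (co z)"] exI[of _ "xcoord t (co z) - height (co z)"]
          exI[of _ "ycoord s (co z)"]) simp
  qed auto
  finally show ?thesis
    unfolding frak_D_def Int_iff mem_V_set region_def
    by (auto simp: mod_coords_linear height_def xcoord_def ycoord_def)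
qed

definition vertex :: "int \<Rightarrow> int \<Rightarrow> real^3" where
  "vertex a b = origin + dir a b"

lemma frak_G_eq: "frak_G B d k = {vertex a b | a b. visible a b}"
proof -
  have "z \<in> frak_G B d k \<longleftrightarrow> co z \<in> g_vectors (symmetrize d B) \<and> co z \<in> region s t" for z
  proof -
    have "z \<in> frak_G B d k \<longleftrightarrow> (\<exists>w j. w \<in> reduced_seqs \<and> z = mod_g_vec B d w j) \<and> z \<in> frak_D B d k"
      by (auto simp: frak_G_def)
    also have "\<dots> \<longleftrightarrow> co z \<in> g_vectors (symmetrize d B) \<and> (z = 0 \<or> co z \<in> region s t)"
      unfolding mod_coords_inject[of z "mod_g_vec B d _ _", symmetric] mod_coords_mod_g mem_frak_D g_vectors_def
      by auto
    finally show ?thesis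
      using height_g_vector[of "co z"] height_co_0 by auto
  qed
  moreover have "co z \<in> g_vectors (symmetrize d B) \<and> co z \<in> region s t \<longleftrightarrow>
    (\<exists>a b. visible a b \<and> co z = pt k s t 1 (of_int a) (of_int b))" for z
    using g_vector_visible[OF cyc, of "co z"] visible_g_vector[OF cyc] pt_in_region[OF cyc]
    by (auto simp: visible_def)
  moreover have "co z = pt k s t 1 (of_int a) (of_int b) \<longleftrightarrow> z = vertex a b" for z a b
    unfolding vertex_def mod_coords_inject[of z, symmetric] co_origin_dir ..
  ultimately have "z \<in> frak_G B d k \<longleftrightarrow> (\<exists>a b. visible a b \<and> z = vertex a b)" for z by simp
  then show ?thesis by blast
qed

lemma phi_vertex: "phi B d k (vertex a b) = ray a b"
  by (simp add: phi_def vertex_def)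

lemma ray_inject:
  assumes v: "visible a b" "visible m n" and "ray a b = ray m n"
  shows "a = m \<and> b = n"
proof -
  obtain z where z: "z \<in> ray a b" using ray_nonempty by blast
  define x y where "x = xcoord t (co z)" and "y = ycoord s (co z)"
  have "co z \<in> shadow s t a b" "co z \<in> shadow s t m n"
    using z assms mem_ray by blast+
  then have x: "0 < x" and e: "of_int a * y = of_int b * x" "of_int m * y = of_int n * x"
    using shadow_subset_region[OF v(1), of s t] by (auto simp: x_def y_def shadow_def region_def)
  have "of_int a * of_int n * x = of_int m * (of_int a * y)"
    by (simp add: e(2)[symmetric])
  also have "\<dots> = of_int b * of_int m * x" unfolding e(1) by simp
  finally have "real_of_int (a * n) = of_int (b * m)" using x by simp
  then have "a * n = b * m" by (simp only: of_int_eq_iff)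
  with v show ?thesis by (rule visible_unique)
qed

lemma uncovered_eq:
  "V_set d - \<Union> (G_fan B d) = {z. 0 < height (co z) \<and> co z \<notin> covered (symmetrize d B)}"
proof -
  have "co 0 \<in> covered (symmetrize d B)" by (rule Nil_covers) (simp add: mod_coords_linear)
  then have "z \<in> V_set d - \<Union> (G_fan B d) \<longleftrightarrow> 0 < height (co z) \<and> co z \<notin> covered (symmetrize d B)" for z
    unfolding Diff_iff mem_V_set mem_G_fan by blast
  then show ?thesis by blast
qed

lemma ray_component:
  assumes v: "visible a b"
  shows "ray a b \<in> components (V_set d - \<Union> (G_fan B d))"
  unfolding in_components_maximal
proof (intro conjI allI impI)
  show "ray a b \<noteq> {}" by (rule ray_nonempty)
  show "ray a b \<subseteq> V_set d - \<Union> (G_fan B d)"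
    unfolding uncovered_eq using mem_ray[OF v] shadow_uncovered[OF cyc v] by (auto simp: shadow_def)
  show "connected (ray a b)" by (intro convex_connected convex_open_cone)
  fix C assume C: "C \<noteq> {} \<and> ray a b \<subseteq> C \<and> C \<subseteq> V_set d - \<Union> (G_fan B d) \<and> connected C"
  have "continuous_on C co" unfolding mod_coords_def by (intro continuous_intros)
  then have "connected (co ` C)" using C connected_continuous_image by blast
  moreover have "co ` C \<subseteq> {z. 0 < height z} - covered (symmetrize d B)"
    using C unfolding uncovered_eq by auto
  moreover obtain x where "x \<in> ray a b" using ray_nonempty by blast
  then have "co x \<in> co ` C" "co x \<in> shadow s t a b" using C mem_ray[OF v] by auto
  ultimately have "co ` C \<subseteq> shadow s t a b" by (rule connected_uncovered[OF cyc v])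
  then show "C = ray a b" using C mem_ray[OF v] by blast
qed

text \<open>
  Every component inside \<open>frak_D\<close> contains an uncovered point of the region, hence meets a ray, and
  different components are disjoint.
\<close>

lemma Com_eq: "Com B d k = {ray a b | a b. visible a b}"
proof (intro equalityI subsetI)
  fix X assume "X \<in> Com B d k"
  then have X: "X \<in> components (V_set d - \<Union> (G_fan B d))" "X \<subseteq> frak_D B d k"
    by (auto simp: Com_def)
  then obtain x where x: "x \<in> X" using in_components_nonempty by blast
  then have "0 < height (co x)" "co x \<notin> covered (symmetrize d B)"
    using in_components_subset[OF X(1)] unfolding uncovered_eq by auto
  moreover have "co x \<in> region s t"
  proof -
    have "x = 0 \<or> co x \<in> region s t" using X(2) x mem_frak_D by blast
    moreover have "x \<noteq> 0" using \<open>0 < height (co x)\<close> height_co_0 by auto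
    ultimately show ?thesis by blast
  qed
  ultimately obtain a b where v: "visible a b" "co x \<in> shadow s t a b"
    using region_covered_or_shadow[OF cyc] by blast
  then have "X \<inter> ray a b \<noteq> {}" using x mem_ray by blast
  then have "X = ray a b" using components_nonoverlap[OF X(1) ray_component[OF v(1)]] by blast
  then show "X \<in> {ray a b | a b. visible a b}" using v(1) by blast
next
  fix X assume "X \<in> {ray a b | a b. visible a b}"
  then obtain a b where v: "visible a b" "X = ray a b" by blast
  have "ray a b \<subseteq> frak_D B d k"
  proof
    fix z assume "z \<in> ray a b"
    then have "co z \<in> region s t" using mem_ray[OF v(1)] shadow_subset_region[OF v(1)] by blast
    then show "z \<in> frak_D B d k" unfolding mem_frak_D ..
  qed
  then show "X \<in> Com B d k" using ray_component[OF v(1)] v(2) by (simp add: Com_def)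
qed

lemma bij_betw_phi: "bij_betw (phi B d k) (frak_G B d k) (Com B d k)"
  unfolding bij_betw_def
proof
  show "inj_on (phi B d k) (frak_G B d k)"
  proof (rule inj_onI)
    fix x y assume xy: "x \<in> frak_G B d k" "y \<in> frak_G B d k" "phi B d k x = phi B d k y"
    obtain a b where x: "visible a b" "x = vertex a b" using xy(1) unfolding frak_G_eq by blast
    obtain m n where y: "visible m n" "y = vertex m n" using xy(2) unfolding frak_G_eq by blast
    have "ray a b = ray m n" using xy(3) unfolding x(2) y(2) phi_vertex .
    then show "x = y" using ray_inject[OF x(1) y(1)] x(2) y(2) by blast
  qed
  show "phi B d k ` frak_G B d k = Com B d k"
    unfolding frak_G_eq Com_eq using phi_vertex by (auto simp: image_iff) blast
qed

lemma rho_ray: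
  assumes "quotient_of x = (b, a)" shows "rho B d k x = ray a b"
  using assms by (simp add: rho_def Let_def)

lemma quotient_visible:
  assumes "quotient_of x = (b, a)" "0 \<le> x" shows "visible a b"
  using quotient_of_denom_pos[OF assms(1)] quotient_of_coprime[OF assms(1)] quotient_of_div[OF assms(1)] assms(2)
  by (auto simp: visible_def coprime_commute zero_le_divide_iff)

lemma bij_betw_rho: "bij_betw (rho B d k) {x. 0 \<le> x} (Com B d k)"
  unfolding bij_betw_def
proof
  show "inj_on (rho B d k) {x. 0 \<le> x}"
  proof (rule inj_onI)
    fix x y assume xy: "x \<in> {x. 0 \<le> x}" "y \<in> {x. 0 \<le> x}" "rho B d k x = rho B d k y"
    obtain a b m n where q: "quotient_of x = (b, a)" "quotient_of y = (n, m)" by fastforce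
    then have "a = m \<and> b = n"
      using xy by (intro ray_inject) (auto simp: quotient_visible simp flip: rho_ray)
    then show "x = y" using q quotient_of_inject by auto
  qed
  show "rho B d k ` {x. 0 \<le> x} = Com B d k"
  proof (intro equalityI subsetI)
    fix X assume "X \<in> rho B d k ` {x. 0 \<le> x}"
    then obtain x where x: "0 \<le> x" "X = rho B d k x" by blast
    obtain a b where q: "quotient_of x = (b, a)" by fastforce
    show "X \<in> Com B d k" unfolding Com_eq x(2) rho_ray[OF q] using quotient_visible[OF q x(1)] by blast
  next
    fix X assume "X \<in> Com B d k"
    then obtain a b where v: "visible a b" and X: "X = ray a b" unfolding Com_eq by blast
    have q: "quotient_of (Fract b a) = (b, a)"
      using v by (simp add: quotient_of_Fract visible_def coprime_commute)
    have "0 \<le> Fract b a" using v by (simp add: visible_def zero_le_Fract_iff)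
    then show "X \<in> rho B d k ` {x. 0 \<le> x}" unfolding X using rho_ray[OF q] by blast
  qed
qed

end

theorem theorem1p4:
  fixes p p' q q' r r' \<sigma> :: real and B :: "real^3^3" and d :: "real^3" and i :: 3
  assumes "p > 0" "p' > 0" "q > 0" "q' > 0" "r > 0" "r' > 0"
    and "p * p' = 4" "q * q' = 4" "r * r' = 4"
    and "p * q * r = p' * q' * r'"
    and "\<sigma> \<in> {1, -1}"
    and "B = \<sigma> *\<^sub>R vector [vector [0, - p', r], vector [p, 0, - q'], vector [- r', q, 0]]"
    and "\<forall>j. d $ j > 0"
    and "skew_symmetric (diag d ** B)"
  shows "bij_betw (phi B d i) (frak_G B d i) (Com B d i) \<and>
         bij_betw (rho B d i) {x :: rat. x \<ge> 0} (Com B d i)"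
proof -
  have d: "0 < d $ j" for j using assms by simp
  have sigma: "\<sigma> = 1 \<or> \<sigma> = - 1" using assms by simp
  interpret skew_symmetrized B d using d by unfold_locales
  have diag_B: "(diag d ** B) $ i $ j = d $ i * B $ i $ j" for i j
  proof -
    have "(diag d ** B) $ i $ j = (\<Sum>k\<in>UNIV. if k = i then d $ i * B $ k $ j else 0)"
      unfolding matrix_matrix_mult_def diag_def vec_lambda_beta by (rule sum.cong) auto
    then show ?thesis by simp
  qed
  have t: "transpose (diag d ** B) = - (diag d ** B)"
    using assms(14) unfolding skew_symmetric_def .
  have skew: "d $ j * B $ j $ i = - (d $ i * B $ i $ j)" for i j
  proof -
    from t have "transpose (diag d ** B) $ i $ j = (- (diag d ** B)) $ i $ j"
      by (simp only:)
    then show ?thesis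
      unfolding transpose_def vec_lambda_beta vector_uminus_component diag_B .
  qed
  have B: "B $ 1 $ 1 = 0" "B $ 2 $ 2 = 0" "B $ 3 $ 3 = 0"
    "B $ 2 $ 1 = \<sigma> * p" "B $ 1 $ 2 = - \<sigma> * p'" "B $ 3 $ 2 = \<sigma> * q" "B $ 2 $ 3 = - \<sigma> * q'"
    "B $ 1 $ 3 = \<sigma> * r" "B $ 3 $ 1 = - \<sigma> * r'"
    unfolding assms(12) by (simp_all add: vector_3)
  note N = symmetrize_pair[OF B(4,5) assms(1,2,7) skew sigma]
    symmetrize_pair[OF B(6,7) assms(3,4,8) skew sigma]
    symmetrize_pair[OF B(8,9) assms(5,6,9) skew sigma]
  have diag: "symmetrize d B $ 1 $ 1 = 0" "symmetrize d B $ 2 $ 2 = 0" "symmetrize d B $ 3 $ 3 = 0"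
    by (simp_all add: symmetrize_def B)
  \<comment> \<open>The global sign only decides the direction of the cycle.\<close>
  have "cyclic (symmetrize d B) 1 2 3 \<or> cyclic (symmetrize d B) 3 2 1"
    using sigma N diag by (auto simp: cyclic_def)
  then have orient: "\<exists>s t. cyclic (symmetrize d B) k s t" for k
    using exhaust_3[of k] cyclic_rotate by blast
  then obtain s t where "cyclic (symmetrize d B) i s t" by blast
  then interpret chart B d i s t using d orient by unfold_locales auto
  show ?thesis using bij_betw_phi bij_betw_rho by blast
qed

end
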